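(* Let $(X,d_X)$ and $(J,d_J)$ be compact metric spaces, $(X,(\phi_j)_{j\in J})$ a uniformly contractible iterated function system, $\nu$ a Borel probability on $J$ with $\operatorname{supp}(\nu)=J$, and $A:J\times X\to\mathbb{R}$ a Lipschitz continuous function. Suppose that the family of Gibbs probabilities $(\rho_{\beta A})_{\beta>0}$ satisfies a large deviation principle and denote by $I$ its deviation function. Suppose that the uniform limit $V=\lim_{\beta\to+\infty}\frac1\beta\log(h_{\beta A})$ exists. Then the uniform limit $q=\lim_{\beta\to+\infty}\frac1\beta\log(q^{\beta})$ exists and satisfies $$q(j,x)=A(j,x)+V(\phi_j(x))-V(x)-m(A),$$ which defines a normalized family of weights. Furthermore, $-I$ is the density of an idempotent probability which is invariant for the max-plus IFS $(X,\phi,q)$; that is, $$-I(x)=\sup_{z\in\Omega_q}\left[S_q(x,z)-I(z)\right]\quad\text{for all }x\in X.$$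
   Context: All metric spaces carry their Borel sigma-algebra; $C(X,\mathbb{R})$ is the set of continuous functions $X\to\mathbb{R}$. Uniformly contractible IFS: a family of maps $\phi_j:X\to X$, $j\in J$, for which there is $0<\gamma<1$ with $d_X(\phi_{j_1}(x_1),\phi_{j_2}(x_2))\le\gamma[d_J(j_1,j_2)+d_X(x_1,x_2)]$ for all $j_1,j_2\in J$, $x_1,x_2\in X$. Write $\phi(j,x)=\phi_j(x)$. Gibbs probabilities: for $\beta>0$ let $\mathcal{L}_{\phi,e^{\beta A},\nu}(f)(x)=\int_J e^{\beta A(j,x)}f(\phi_j(x))\,d\nu(j)$, $f\in C(X,\mathbb{R})$. There is a unique pair $(\lambda_{\beta A},h_{\beta A})$ with $\lambda_{\beta A}>0$ a number, $h_{\beta A}:X\to\mathbb{R}$ positive and continuous, $\sup_X h_{\beta A}=1$, and $\mathcal{L}_{\phi,e^{\beta A},\nu}(h_{\beta A})=\lambda_{\beta A}h_{\beta A}$. Put $q^{\beta}(j,x)=\frac{e^{\beta A(j,x)}h_{\beta A}(\phi_j(x))}{\lambda_{\beta A}h_{\beta A}(x)}$. The Gibbs probability $\rho_{\beta A}$ is the unique Borel probability on $X$ with $\int_X f\,d\rho_{\beta A}=\int_X\int_J q^{\beta}(j,x)f(\phi_j(x))\,d\nu(j)\,d\rho_{\beta A}(x)$ for all $f\in C(X,\mathbb{R})$. Holonomic probabilities and $m$: a Borel probability $\pi$ on $J\times X$ is holonomic if $\int g(x)\,d\pi(j,x)=\int g(\phi_j(x))\,d\pi(j,x)$ for all $g\in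 C(X,\mathbb{R})$; $\mathcal{H}$ is the set of these. For continuous $B:J\times X\to\mathbb{R}$, $m(B)=\sup_{\pi\in\mathcal{H}}\int B\,d\pi$. Mañé potential and Aubry set of a continuous $B:J\times X\to\mathbb{R}$: for $n\ge1$, $\omega=(j_1,\ldots,j_n)\in J^n$, put $\phi_\omega(y)=\phi_{j_1}\circ\cdots\circ\phi_{j_n}(y)$ and $\mathrm{Sum}(B,\omega,y)=B(j_1,\phi_{(j_2,\ldots,j_n)}(y))+B(j_2,\phi_{(j_3,\ldots,j_n)}(y))+\cdots+B(j_n,y)-n\,m(B)$. Then $S_{B,\varepsilon}(x,y)=\sup_{n\ge1}\sup\{\mathrm{Sum}(B,\omega,y):\omega\in J^n,\ d_X(x,\phi_\omega(y))<\varepsilon\}$ (with $\sup\emptyset=-\infty$), $S_B(x,y)=\lim_{\varepsilon\to0}S_{B,\varepsilon}(x,y)$, and $\Omega_B=\{x\in X: S_B(x,x)=0\}$. Normalized family of weights / max-plus IFS: $q:J\times X\to\mathbb{R}$, $q_j(x)=q(j,x)$, is a normalized family of weights if $q$ is continuous, there is $C>0$ with $|q_j(x_1)-q_j(x_2)|\le C\,d_X(x_1,x_2)$ for all $j,x_1,x_2$, and $\sup_{j\in J}q_j(x)=0$ for all $x\in X$. Then $(X,\phi,q)$ is called a max-plus IFS. Idempotent probabilities: a functional $\mu:C(X,\mathbb{R})\to\mathbb{R}$ is an idempotent probability if $\mu(a+f)=a+\mu(f)$ for $a\in\mathbb{R}$, $\mu(\max(f,g))=\max(\mu(f),\mu(g))$,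 and $\mu(0)=0$. Each such $\mu$ has a unique upper semi-continuous density $\lambda:X\to\mathbb{R}\cup\{-\infty\}$, i.e. $\sup_X\lambda=0$ and $\mu(f)=\sup_{x\in X}[\lambda(x)+f(x)]$ for all $f\in C(X,\mathbb{R})$. It is invariant for $(X,\phi,q)$ if $\mu(f)=\sup_{j\in J}\mu(q_j+f\circ\phi_j)$ for all $f\in C(X,\mathbb{R})$. Large deviation principle: $(\mu_\beta)_{\beta>0}$ satisfies a large deviation principle with rate (deviation) function $I$ if $I:X\to[0,+\infty]$ is lower semi-continuous and $\limsup_{\beta\to+\infty}\frac1\beta\log\mu_\beta(C)\le-\inf_C I$ for each closed $C\subset X$, $\liminf_{\beta\to+\infty}\frac1\beta\log\mu_\beta(U)\ge-\inf_U I$ for each open $U\subset X$ (with $\log0=-\infty$, $-\inf_\emptyset I=-\infty$). Convention: any sum with a term equal to $-\infty$ (and no term $+\infty$) is $-\infty$. *)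

theory Defs
  imports "HOL-Probability.Probability"
begin

definition uniformly_contractible :: "('j::metric_space \<Rightarrow> 'x::metric_space \<Rightarrow> 'x) \<Rightarrow> bool" where
  "uniformly_contractible \<phi> \<longleftrightarrow>
     (\<exists>\<gamma>. 0 < \<gamma> \<and> \<gamma> < 1 \<and>
       (\<forall>j\<^sub>1 j\<^sub>2 x\<^sub>1 x\<^sub>2. dist (\<phi> j\<^sub>1 x\<^sub>1) (\<phi> j\<^sub>2 x\<^sub>2) \<le> \<gamma> * (dist j\<^sub>1 j\<^sub>2 + dist x\<^sub>1 x\<^sub>2)))"

definition borel_probability :: "'a::topological_space measure \<Rightarrow> bool" where
  "borel_probability \<mu> \<longleftrightarrow> prob_space \<mu> \<and> sets \<mu> = sets borel"

definition measure_support :: "'a::topological_space measure \<Rightarrow> 'a set" where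
  "measure_support \<mu> = {x. \<forall>U. open U \<and> x \<in> U \<longrightarrow> emeasure \<mu> U > 0}"


subsection \<open>Gibbs probabilities\<close>

definition transfer_operator ::
  "('j \<Rightarrow> 'x \<Rightarrow> 'x) \<Rightarrow> ('j \<times> 'x \<Rightarrow> real) \<Rightarrow> 'j measure \<Rightarrow> ('x \<Rightarrow> real) \<Rightarrow> 'x \<Rightarrow> real" where
  "transfer_operator \<phi> w \<nu> f x = (\<integral>j. w (j, x) * f (\<phi> j x) \<partial>\<nu>)"

definition gibbs_eigenpair ::
  "('j \<Rightarrow> 'x::metric_space \<Rightarrow> 'x) \<Rightarrow> 'j measure \<Rightarrow> ('j \<times> 'x \<Rightarrow> real) \<Rightarrow> real \<Rightarrow> real \<Rightarrow> ('x \<Rightarrow> real) \<Rightarrow> bool"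
  where
  "gibbs_eigenpair \<phi> \<nu> A \<beta> lam h \<longleftrightarrow>
     lam > 0 \<and> continuous_on UNIV h \<and> (\<forall>x. h x > 0) \<and> (SUP x. h x) = 1 \<and>
     (\<forall>x. transfer_operator \<phi> (\<lambda>z. exp (\<beta> * A z)) \<nu> h x = lam * h x)"

definition gibbs_weight ::
  "('j \<Rightarrow> 'x \<Rightarrow> 'x) \<Rightarrow> ('j \<times> 'x \<Rightarrow> real) \<Rightarrow> real \<Rightarrow> real \<Rightarrow> ('x \<Rightarrow> real) \<Rightarrow> 'j \<times> 'x \<Rightarrow> real" where
  "gibbs_weight \<phi> A \<beta> lam h = (\<lambda>(j, x). exp (\<beta> * A (j, x)) * h (\<phi> j x) / (lam * h x))"

definition gibbs_probability ::
  "('j \<Rightarrow> 'x::metric_space \<Rightarrow> 'x) \<Rightarrow> 'j measure \<Rightarrow> ('j \<times> 'x \<Rightarrow> real) \<Rightarrow> real \<Rightarrow> real \<Rightarrow> ('x \<Rightarrow> real) \<Rightarrow>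
     'x measure \<Rightarrow> bool"
  where
  "gibbs_probability \<phi> \<nu> A \<beta> lam h \<rho> \<longleftrightarrow>
     borel_probability \<rho> \<and>
     (\<forall>f. continuous_on UNIV f \<longrightarrow>
        (\<integral>x. f x \<partial>\<rho>) = (\<integral>x. (\<integral>j. gibbs_weight \<phi> A \<beta> lam h (j, x) * f (\<phi> j x) \<partial>\<nu>) \<partial>\<rho>))"


subsection \<open>Holonomic probabilities, Mane potential and Aubry set\<close>

definition holonomic ::
  "('j::metric_space \<Rightarrow> 'x::metric_space \<Rightarrow> 'x) \<Rightarrow> ('j \<times> 'x) measure set" where
  "holonomic \<phi> =
     {\<pi>. borel_probability \<pi> \<and>
        (\<forall>g::'x \<Rightarrow> real. continuous_on UNIV g \<longrightarrow>
           (\<integral>(j, x). g x \<partial>\<pi>) = (\<integral>(j, x). g (\<phi> j x) \<partial>\<pi>))}"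

definition max_holonomic ::
  "('j::metric_space \<Rightarrow> 'x::metric_space \<Rightarrow> 'x) \<Rightarrow> ('j \<times> 'x \<Rightarrow> real) \<Rightarrow> real" where
  "max_holonomic \<phi> B = (SUP \<pi>\<in>holonomic \<phi>. \<integral>z. B z \<partial>\<pi>)"

text \<open>For a word \<open>\<omega> = [j\<^sub>1, \<dots>, j\<^sub>n]\<close>, the composition \<open>\<phi>\<^bsub>j\<^sub>1\<^esub> \<circ> \<dots> \<circ> \<phi>\<^bsub>j\<^sub>n\<^esub>\<close> is \<open>foldr \<phi> \<omega>\<close>.\<close>

definition mane_sum ::
  "('j::metric_space \<Rightarrow> 'x::metric_space \<Rightarrow> 'x) \<Rightarrow> ('j \<times> 'x \<Rightarrow> real) \<Rightarrow> 'j list \<Rightarrow> 'x \<Rightarrow> real" where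
  "mane_sum \<phi> B \<omega> y =
     (\<Sum>k<length \<omega>. B (\<omega> ! k, foldr \<phi> (drop (Suc k) \<omega>) y)) - real (length \<omega>) * max_holonomic \<phi> B"

definition mane_eps ::
  "('j::metric_space \<Rightarrow> 'x::metric_space \<Rightarrow> 'x) \<Rightarrow> ('j \<times> 'x \<Rightarrow> real) \<Rightarrow> real \<Rightarrow> 'x \<Rightarrow> 'x \<Rightarrow> ereal" where
  "mane_eps \<phi> B \<epsilon> x y =
     (SUP n\<in>{1..}. SUP \<omega>\<in>{\<omega>. length \<omega> = n \<and> dist x (foldr \<phi> \<omega> y) < \<epsilon>}. ereal (mane_sum \<phi> B \<omega> y))"

definition mane_potential ::
  "('j::metric_space \<Rightarrow> 'x::metric_space \<Rightarrow> 'x) \<Rightarrow> ('j \<times> 'x \<Rightarrow> real) \<Rightarrow> 'x \<Rightarrow> 'x \<Rightarrow> ereal" where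
  "mane_potential \<phi> B x y = Lim (at_right 0) (\<lambda>\<epsilon>. mane_eps \<phi> B \<epsilon> x y)"

definition aubry_set ::
  "('j::metric_space \<Rightarrow> 'x::metric_space \<Rightarrow> 'x) \<Rightarrow> ('j \<times> 'x \<Rightarrow> real) \<Rightarrow> 'x set" where
  "aubry_set \<phi> B = {x. mane_potential \<phi> B x x = 0}"


subsection \<open>Max-plus IFS and idempotent probabilities\<close>

definition normalized_weights :: "('j::metric_space \<times> 'x::metric_space \<Rightarrow> real) \<Rightarrow> bool" where
  "normalized_weights q \<longleftrightarrow>
     continuous_on UNIV q \<and>
     (\<exists>C>0. \<forall>j x\<^sub>1 x\<^sub>2. \<bar>q (j, x\<^sub>1) - q (j, x\<^sub>2)\<bar> \<le> C * dist x\<^sub>1 x\<^sub>2) \<and>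
     (\<forall>x. (SUP j. q (j, x)) = 0)"

text \<open>
  A functional on the space of continuous functions is represented by a function on the type
  \<open>'x \<Rightarrow> real\<close>, whose values at discontinuous arguments are never used.
\<close>

definition idempotent_probability :: "(('x::metric_space \<Rightarrow> real) \<Rightarrow> real) \<Rightarrow> bool" where
  "idempotent_probability \<mu> \<longleftrightarrow>
     (\<forall>a f. continuous_on UNIV f \<longrightarrow> \<mu> (\<lambda>x. a + f x) = a + \<mu> f) \<and>
     (\<forall>f g. continuous_on UNIV f \<longrightarrow> continuous_on UNIV g \<longrightarrow>
        \<mu> (\<lambda>x. max (f x) (g x)) = max (\<mu> f) (\<mu> g)) \<and>
     \<mu> (\<lambda>x. 0) = 0"

definition lower_semicontinuous :: "('x::topological_space \<Rightarrow> ereal) \<Rightarrow> bool" where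
  "lower_semicontinuous f \<longleftrightarrow> (\<forall>x. f x \<le> Liminf (at x) f)"

definition upper_semicontinuous :: "('x::topological_space \<Rightarrow> ereal) \<Rightarrow> bool" where
  "upper_semicontinuous f \<longleftrightarrow> (\<forall>x. Limsup (at x) f \<le> f x)"

definition idempotent_density ::
  "(('x::metric_space \<Rightarrow> real) \<Rightarrow> real) \<Rightarrow> ('x \<Rightarrow> ereal) \<Rightarrow> bool" where
  "idempotent_density \<mu> l \<longleftrightarrow>
     upper_semicontinuous l \<and> (SUP x. l x) = 0 \<and>
     (\<forall>f. continuous_on UNIV f \<longrightarrow> ereal (\<mu> f) = (SUP x. l x + ereal (f x)))"

definition maxplus_invariant ::
  "('j \<Rightarrow> 'x::metric_space \<Rightarrow> 'x) \<Rightarrow> ('j \<times> 'x \<Rightarrow> real) \<Rightarrow> (('x \<Rightarrow> real) \<Rightarrow> real) \<Rightarrow> bool" where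
  "maxplus_invariant \<phi> q \<mu> \<longleftrightarrow>
     (\<forall>f. continuous_on UNIV f \<longrightarrow> \<mu> f = (SUP j. \<mu> (\<lambda>x. q (j, x) + f (\<phi> j x))))"


subsection \<open>Large deviations\<close>

definition ext_ln :: "real \<Rightarrow> ereal" where
  "ext_ln p = (if p = 0 then -\<infinity> else ereal (ln p))"

definition large_deviation_principle ::
  "(real \<Rightarrow> 'x::topological_space measure) \<Rightarrow> ('x \<Rightarrow> ereal) \<Rightarrow> bool" where
  "large_deviation_principle \<mu> I \<longleftrightarrow>
     (\<forall>x. 0 \<le> I x) \<and> lower_semicontinuous I \<and>
     (\<forall>C. closed C \<longrightarrow>
        Limsup at_top (\<lambda>\<beta>. ereal (1 / \<beta>) * ext_ln (measure (\<mu> \<beta>) C)) \<le> - (INF x\<in>C. I x)) \<and>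
     (\<forall>U. open U \<longrightarrow>
        Liminf at_top (\<lambda>\<beta>. ereal (1 / \<beta>) * ext_ln (measure (\<mu> \<beta>) U)) \<ge> - (INF x\<in>U. I x))"

end

theory Submission
  imports Defs
begin

text \<open>
  Everything is read off on the scale \<open>(1/\<beta>) ln\<close>.  Put \<open>U = (1/\<beta>) ln (h \<beta>)\<close>, so that \<open>U\<close> tends to \<open>V\<close>.
  Dividing the eigenvalue equation by \<open>h \<beta> x\<close> gives
  \<open>lam \<beta> = \<integral> exp (\<beta> (A (j, x) + U (\<phi> j x) - U x)) d\<nu>(j)\<close>, and since \<open>\<nu>\<close> charges every ball, the Laplace principle
  (\<open>laplace_uniform_limit\<close>) shows that \<open>(1/\<beta>) ln (lam \<beta>)\<close> tends to \<open>sup\<^sub>j (A (j, x) + V (\<phi> j x) - V x)\<close>,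
  whatever \<open>x\<close> is.  This number is \<open>m(A)\<close>.  Integrating the expression under the supremum against a
  holonomic probability, where the two terms with \<open>V\<close> cancel, shows that it is at least \<open>m(A)\<close>.
  Conversely, \<open>\<rho> \<beta>\<close> and the Gibbs weight together define a holonomic probability on pairs; its relative
  entropy is nonnegative, which says that \<open>A\<close> has integral at least \<open>(1/\<beta>) ln (lam \<beta>)\<close>.  The formula for
  \<open>q\<close> and the equation \<open>sup\<^sub>j q = 0\<close> follow.  The Lipschitz bound for \<open>q\<close> comes from \<open>V\<close>, whose modulus of
  continuity the supremum equation contracts (\<open>calibrated_lipschitz\<close>).

  For continuous \<open>f\<close>, the invariance of \<open>\<rho> \<beta>\<close> writes \<open>\<integral> exp (\<beta> f) d\<rho>\<close> as a double integral over \<open>j\<close> and \<open>x\<close>.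
  Varadhan's lemma for the integrals over \<open>x\<close> and the Laplace principle for the one over \<open>j\<close> turn this
  identity into the max-plus invariance of \<open>f \<mapsto> sup (f - I)\<close> (\<open>maxplus_integral_invariant\<close>).

  The representation on the Aubry set is then a statement about a density \<open>l = - I\<close> alone.  Functions
  \<open>- K d(x, _)\<close> with large \<open>K\<close> localise the invariance: \<open>l (\<phi> j z) \<ge> l z + q (j, z)\<close> always, and every point
  of finite density has a preimage with equality.  Following words forward gives
  \<open>l x \<ge> S(x, z) + l z\<close>.  Following optimal preimages backward gives an orbit along which \<open>l\<close> increases to
  a finite limit; it accumulates at a point \<open>z\<close> of the Aubry set with \<open>l x \<le> S(x, z) + l z\<close>
  (\<open>density_le_aubry\<close>).
\<close>

section \<open>Compactness\<close>

lemma compact_UNIV_Pair: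
  assumes "compact (UNIV :: 'a::topological_space set)" and "compact (UNIV :: 'b::topological_space set)"
  shows "compact (UNIV :: ('a \<times> 'b) set)"
  using compact_Times[OF assms] by simp

lemma compact_continuous_bounded:
  fixes f :: "'a::topological_space \<Rightarrow> real"
  assumes "compact (UNIV :: 'a set)" and "continuous_on UNIV f"
  obtains M where "M > 0" and "\<And>x. \<bar>f x\<bar> \<le> M"
proof -
  have "bounded (range f)"
    using assms by (intro compact_imp_bounded compact_continuous_image)
  then obtain M where "M > 0" "\<And>x. norm (f x) \<le> M"
    unfolding bounded_pos by auto
  then show ?thesis using that by auto
qed

lemma abs_SUP_diff_le:
  fixes f g :: "'a \<Rightarrow> real"
  assumes "bdd_above (range f)" and "bdd_above (range g)" and "\<And>j. \<bar>f j - g j\<bar> \<le> e"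
  shows "\<bar>(SUP j. f j) - (SUP j. g j)\<bar> \<le> e"
proof -
  have "f j \<le> (SUP j. g j) + e" for j
    using cSUP_upper[OF UNIV_I assms(2), of j] assms(3)[of j] by linarith
  then have 1: "(SUP j. f j) \<le> (SUP j. g j) + e" by (intro cSUP_least) auto
  have "g j \<le> (SUP j. f j) + e" for j
    using cSUP_upper[OF UNIV_I assms(1), of j] assms(3)[of j] by linarith
  then have 2: "(SUP j. g j) \<le> (SUP j. f j) + e" by (intro cSUP_least) auto
  from 1 2 show ?thesis by linarith
qed

text \<open>
  Partial suprema and partial integrals inherit the modulus of continuity of a function of two
  variables, because on a compact product that modulus is uniform.
\<close>

lemma compact_uniform_modulus:
  fixes G :: "'j::metric_space \<times> 'x::metric_space \<Rightarrow> real"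
  assumes "compact (UNIV :: 'j set)" and "compact (UNIV :: 'x set)" and "continuous_on UNIV G" and "e > 0"
  obtains d where "d > 0"
    and "\<And>j x y. dist x y < d \<Longrightarrow> \<bar>G (j, x) - G (j, y)\<bar> < e"
    and "\<And>i j x. dist i j < d \<Longrightarrow> \<bar>G (i, x) - G (j, x)\<bar> < e"
proof -
  have "uniformly_continuous_on UNIV G"
    using assms compact_UNIV_Pair by (intro compact_uniformly_continuous) auto
  then obtain d where d: "d > 0" "\<And>z w. dist w z < d \<Longrightarrow> dist (G w) (G z) < e"
    using \<open>e > 0\<close> unfolding uniformly_continuous_on_def by (metis UNIV_I)
  show ?thesis
    by (rule that[of d]) (use d in \<open>auto simp: dist_Pair_Pair dist_real_def\<close>)
qed

lemma bdd_above_section: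
  fixes G :: "'j::metric_space \<times> 'x::metric_space \<Rightarrow> real"
  assumes "compact (UNIV :: 'j set)" and "compact (UNIV :: 'x set)" and "continuous_on UNIV G"
  shows "bdd_above (range (\<lambda>j. G (j, x)))"
proof -
  obtain M where "\<And>z. \<bar>G z\<bar> \<le> M"
    using compact_continuous_bounded[OF compact_UNIV_Pair[OF assms(1,2)] assms(3)] by metis
  then show ?thesis by (intro bdd_aboveI[of _ M]) (auto simp: abs_le_iff)
qed

lemma continuous_on_SUP_section:
  fixes G :: "'j::metric_space \<times> 'x::metric_space \<Rightarrow> real"
  assumes "compact (UNIV :: 'j set)" and "compact (UNIV :: 'x set)" and "continuous_on UNIV G"
  shows "continuous_on UNIV (\<lambda>x. SUP j. G (j, x))"
  unfolding continuous_on_iff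
proof (intro ballI allI impI)
  fix x :: 'x and e :: real assume "e > 0"
  then obtain d where d: "d > 0" "\<And>j x y. dist x y < d \<Longrightarrow> \<bar>G (j, x) - G (j, y)\<bar> < e / 2"
    using compact_uniform_modulus[OF assms, of "e / 2"] by (metis half_gt_zero)
  have "dist (SUP j. G (j, y)) (SUP j. G (j, x)) < e" if "dist y x < d" for y
  proof -
    have "\<bar>(SUP j. G (j, y)) - (SUP j. G (j, x))\<bar> \<le> e / 2"
      using d(2)[OF that] by (intro abs_SUP_diff_le bdd_above_section[OF assms]) (auto intro: less_imp_le)
    then show ?thesis using \<open>e > 0\<close> by (simp add: dist_real_def)
  qed
  then show "\<exists>d>0. \<forall>y\<in>UNIV. dist y x < d \<longrightarrow> dist (SUP j. G (j, y)) (SUP j. G (j, x)) < e"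
    using d(1) by blast
qed

lemma borel_probability_measurable:
  fixes f :: "'a::topological_space \<Rightarrow> real"
  assumes "borel_probability \<mu>" and "continuous_on UNIV f"
  shows "f \<in> borel_measurable \<mu>"
proof -
  have "sets \<mu> = sets borel" using assms(1) by (simp add: borel_probability_def)
  then show ?thesis
    using borel_measurable_continuous_onI[OF assms(2)] measurable_cong_sets by blast
qed

lemma borel_probability_space: "borel_probability \<mu> \<Longrightarrow> space \<mu> = UNIV"
  unfolding borel_probability_def using sets_eq_imp_space_eq[of \<mu> borel] by simp

lemma borel_probability_integrable:
  fixes f :: "'a::topological_space \<Rightarrow> real"
  assumes "borel_probability \<mu>" and "compact (UNIV :: 'a set)" and "continuous_on UNIV f"
  shows "integrable \<mu> f"
proof -
  interpret prob_space \<mu> using assms(1) by (simp add: borel_probability_def)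
  obtain M where "\<And>x. \<bar>f x\<bar> \<le> M" using compact_continuous_bounded[OF assms(2,3)] by metis
  then show ?thesis
    by (intro integrable_const_bound[of _ M] borel_probability_measurable[OF assms(1,3)]) auto
qed

lemma continuous_on_section:
  assumes "continuous_on UNIV (G :: 'j::topological_space \<times> 'x::topological_space \<Rightarrow> real)"
  shows "continuous_on UNIV (\<lambda>j. G (j, x))"
  by (rule continuous_on_compose2[OF assms]) (auto intro!: continuous_intros)

lemma continuous_on_integral_section:
  fixes G :: "'j::metric_space \<times> 'x::metric_space \<Rightarrow> real"
  assumes "compact (UNIV :: 'j set)" and "compact (UNIV :: 'x set)" and "continuous_on UNIV G"
    and \<nu>: "borel_probability \<nu>"
  shows "continuous_on UNIV (\<lambda>x. \<integral>j. G (j, x) \<partial>\<nu>)"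
  unfolding continuous_on_iff
proof (intro ballI allI impI)
  interpret prob_space \<nu> using \<nu> by (simp add: borel_probability_def)
  fix x :: 'x and e :: real assume "e > 0"
  then obtain d where d: "d > 0" "\<And>j x y. dist x y < d \<Longrightarrow> \<bar>G (j, x) - G (j, y)\<bar> < e / 2"
    using compact_uniform_modulus[OF assms(1-3), of "e / 2"] by (metis half_gt_zero)
  have int: "integrable \<nu> (\<lambda>j. G (j, y))" for y
    using continuous_on_section[OF assms(3)] by (rule borel_probability_integrable[OF \<nu> assms(1)])
  have "dist (\<integral>j. G (j, y) \<partial>\<nu>) (\<integral>j. G (j, x) \<partial>\<nu>) < e" if "dist y x < d" for y
  proof -
    have "\<bar>(\<integral>j. G (j, y) \<partial>\<nu>) - (\<integral>j. G (j, x) \<partial>\<nu>)\<bar> = \<bar>\<integral>j. G (j, y) - G (j, x) \<partial>\<nu>\<bar>"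
      using int by simp
    also have "\<dots> \<le> (\<integral>j. \<bar>G (j, y) - G (j, x)\<bar> \<partial>\<nu>)" by (rule integral_abs_bound)
    also have "\<dots> \<le> (\<integral>j. e / 2 \<partial>\<nu>)"
      using int d(2)[OF that] by (intro integral_mono) (auto intro: less_imp_le)
    also have "\<dots> = e / 2" by (simp add: prob_space)
    finally show ?thesis using \<open>e > 0\<close> by (simp add: dist_real_def)
  qed
  then show "\<exists>d>0. \<forall>y\<in>UNIV. dist y x < d \<longrightarrow> dist (\<integral>j. G (j, y) \<partial>\<nu>) (\<integral>j. G (j, x) \<partial>\<nu>) < e"
    using d(1) by blast
qed

text \<open>
  A compact metric space is second countable, although its type need not be an instance of the
  corresponding class.  Balls of radius \<open>1/n\<close> around finitely many centres for each \<open>n\<close> show that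
  every open set of the product is a countable union of open rectangles, so that a measure on the
  product sigma-algebra is a Borel measure.
\<close>

lemma compact_countable_centres:
  assumes "compact (UNIV :: 'a::metric_space set)"
  shows "\<exists>D :: 'a set. countable D \<and> (\<forall>x. \<forall>e>0. \<exists>d\<in>D. dist d x < e)"
proof -
  have "\<exists>K. finite K \<and> (UNIV :: 'a set) \<subseteq> (\<Union>x\<in>K. ball x (1 / real (Suc n)))" for n
    using assms compact_imp_seq_compact seq_compact_imp_totally_bounded
    by (metis of_nat_0_less_iff zero_less_Suc zero_less_divide_1_iff)
  then obtain K where K: "\<And>n. finite (K n)" "\<And>n. (UNIV :: 'a set) \<subseteq> (\<Union>x\<in>K n. ball x (1 / real (Suc n)))"
    by metis
  show ?thesis
  proof (intro exI[of _ "\<Union>n. K n"] conjI allI impI)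
    show "countable (\<Union>n. K n)" using K(1) by (auto intro: countable_finite)
    fix x :: 'a and e :: real assume "e > 0"
    then obtain n where n: "1 / real (Suc n) < e" using nat_approx_posE by metis
    have "x \<in> (\<Union>y\<in>K n. ball y (1 / real (Suc n)))" using K(2)[of n] by blast
    then obtain d where "d \<in> K n" "dist d x < 1 / real (Suc n)" unfolding UN_iff mem_ball by blast
    then show "\<exists>d\<in>\<Union>n. K n. dist d x < e" using n by (metis UN_I UNIV_I less_trans)
  qed
qed

lemma sets_borel_pair_compact:
  assumes "compact (UNIV :: 'a::metric_space set)" and "compact (UNIV :: 'b::metric_space set)"
  shows "sets (borel \<Otimes>\<^sub>M borel) = sets (borel :: ('a \<times> 'b) measure)"
proof
  have "fst -` A \<in> sets (borel :: ('a \<times> 'b) measure)" if "A \<in> sets borel" for A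
    using measurable_sets[OF borel_measurable_continuous_onI[OF continuous_on_fst[OF continuous_on_id]] that] by simp
  moreover have "snd -` A \<in> sets (borel :: ('a \<times> 'b) measure)" if "A \<in> sets borel" for A
    using measurable_sets[OF borel_measurable_continuous_onI[OF continuous_on_snd[OF continuous_on_id]] that] by simp
  moreover have "A \<times> B = fst -` A \<inter> snd -` B" for A :: "'a set" and B :: "'b set" by auto
  ultimately have "A \<times> B \<in> sets (borel :: ('a \<times> 'b) measure)" if "A \<in> sets borel" "B \<in> sets borel" for A B
    using that sets.Int by metis
  then show "sets (borel \<Otimes>\<^sub>M borel) \<subseteq> sets (borel :: ('a \<times> 'b) measure)"
    unfolding sets_pair_measure by (intro sets.sigma_sets_subset') auto
  obtain D :: "'a set" where D: "countable D" "\<And>x e. e > 0 \<Longrightarrow> \<exists>d\<in>D. dist d x < e"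
    using compact_countable_centres[OF assms(1)] by blast
  obtain E :: "'b set" where E: "countable E" "\<And>x e. e > 0 \<Longrightarrow> \<exists>d\<in>E. dist d x < e"
    using compact_countable_centres[OF assms(2)] by blast
  have "U \<in> sets (borel \<Otimes>\<^sub>M borel)" if "open U" for U :: "('a \<times> 'b) set"
  proof -
    define P where "P = {(d, e, n). d \<in> D \<and> e \<in> E \<and> ball d (1 / real (Suc n)) \<times> ball e (1 / real (Suc n)) \<subseteq> U}"
    have "P \<subseteq> D \<times> E \<times> UNIV" by (auto simp: P_def)
    then have "countable P"
      by (rule countable_subset) (intro countable_SIGMA D(1) E(1) countableI_type)
    have "U = (\<Union>(d, e, n)\<in>P. ball d (1 / real (Suc n)) \<times> ball e (1 / real (Suc n)))"
    proof (intro equalityI subsetI)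
      fix z assume "z \<in> U"
      obtain x y where z: "z = (x, y)" by (cases z)
      obtain A B where "open A" "open B" "(x, y) \<in> A \<times> B" "A \<times> B \<subseteq> U"
        using \<open>open U\<close> \<open>z \<in> U\<close> unfolding z by (rule open_prod_elim)
      then have AB: "open A" "open B" "x \<in> A" "y \<in> B" "A \<times> B \<subseteq> U" by auto
      obtain e1 where e1: "e1 > 0" "ball x e1 \<subseteq> A" using AB by (meson open_contains_ball)
      obtain e2 where e2: "e2 > 0" "ball y e2 \<subseteq> B" using AB by (meson open_contains_ball)
      obtain n where n: "1 / real (Suc n) < min e1 e2 / 2"
        using nat_approx_posE[of "min e1 e2 / 2"] e1(1) e2(1) by auto
      have r: "1 / real (Suc n) > 0" by simp
      obtain d where d: "d \<in> D" "dist d x < 1 / real (Suc n)" using D(2)[OF r] by blast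
      obtain e where e: "e \<in> E" "dist e y < 1 / real (Suc n)" using E(2)[OF r] by blast
      have "ball d (1 / real (Suc n)) \<subseteq> A"
      proof
        fix w assume "w \<in> ball d (1 / real (Suc n))"
        then have "dist x w < e1" using d n dist_triangle[of x w d] by (auto simp: dist_commute)
        then show "w \<in> A" using e1 by auto
      qed
      moreover have "ball e (1 / real (Suc n)) \<subseteq> B"
      proof
        fix w assume "w \<in> ball e (1 / real (Suc n))"
        then have "dist y w < e2" using e n dist_triangle[of y w e] by (auto simp: dist_commute)
        then show "w \<in> B" using e2 by auto
      qed
      ultimately have "(d, e, n) \<in> P" using d e AB(5) unfolding P_def by blast
      moreover have "z \<in> ball d (1 / real (Suc n)) \<times> ball e (1 / real (Suc n))"
        using d e z by auto
      ultimately show "z \<in> (\<Union>(d, e, n)\<in>P. ball d (1 / real (Suc n)) \<times> ball e (1 / real (Suc n)))"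
        by blast
    qed (auto simp: P_def)
    also have "\<dots> \<in> sets (borel \<Otimes>\<^sub>M borel)"
      using \<open>countable P\<close> by (intro sets.countable_UN') (auto split: prod.splits)
    finally show ?thesis .
  qed
  moreover have "sets (borel :: ('a \<times> 'b) measure) = sigma_sets UNIV {U. open U}"
    unfolding borel_def by (rule sets_measure_of) simp
  ultimately show "sets (borel :: ('a \<times> 'b) measure) \<subseteq> sets (borel \<Otimes>\<^sub>M borel)"
    using sets.sigma_sets_subset[of "{U. open U}" "borel \<Otimes>\<^sub>M borel :: ('a \<times> 'b) measure"]
    by (auto simp: space_pair_measure)
qed


section \<open>The Laplace principle\<close>

text \<open>
  Finitely many balls of radius \<open>d / 2\<close> cover the space, and every ball of radius \<open>d\<close> contains one of them.
\<close>

lemma ball_measure_lower_bound: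
  fixes \<nu> :: "'j::metric_space measure"
  assumes "compact (UNIV :: 'j set)" and \<nu>: "borel_probability \<nu>" and supp: "measure_support \<nu> = UNIV"
    and "d > 0"
  obtains \<kappa> where "\<kappa> > 0" and "\<And>j. measure \<nu> (ball j d) \<ge> \<kappa>"
proof -
  interpret prob_space \<nu> using \<nu> by (simp add: borel_probability_def)
  have sets: "ball j r \<in> sets \<nu>" for j r using \<nu> by (simp add: borel_probability_def)
  have "\<exists>K. finite K \<and> (UNIV :: 'j set) \<subseteq> (\<Union>x\<in>K. ball x (d / 2))"
    using assms(1,4) compact_imp_seq_compact seq_compact_imp_totally_bounded by (metis half_gt_zero)
  then obtain K where K: "finite K" "(UNIV :: 'j set) \<subseteq> (\<Union>x\<in>K. ball x (d / 2))" by blast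
  then have "K \<noteq> {}" by auto
  define \<kappa> where "\<kappa> = Min ((\<lambda>x. measure \<nu> (ball x (d / 2))) ` K)"
  have "measure \<nu> (ball x (d / 2)) > 0" for x
  proof -
    have "x \<in> measure_support \<nu>" using supp by simp
    then have "emeasure \<nu> (ball x (d / 2)) > 0" using \<open>d > 0\<close> unfolding measure_support_def by simp
    then show ?thesis by (simp add: emeasure_eq_measure)
  qed
  then have "\<kappa> > 0" unfolding \<kappa>_def using K(1) \<open>K \<noteq> {}\<close> by simp
  moreover have "measure \<nu> (ball j d) \<ge> \<kappa>" for j
  proof -
    have "j \<in> (\<Union>x\<in>K. ball x (d / 2))" using K(2) by blast
    then obtain x where x: "x \<in> K" "dist x j < d / 2" unfolding UN_iff mem_ball by blast
    have "ball x (d / 2) \<subseteq> ball j d"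
    proof
      fix w assume "w \<in> ball x (d / 2)"
      then show "w \<in> ball j d" using x(2) dist_triangle[of j w x] by (auto simp: dist_commute)
    qed
    then have "measure \<nu> (ball x (d / 2)) \<le> measure \<nu> (ball j d)" using sets by (intro finite_measure_mono)
    moreover have "\<kappa> \<le> measure \<nu> (ball x (d / 2))" unfolding \<kappa>_def using K(1) x(1) by simp
    ultimately show ?thesis by linarith
  qed
  ultimately show ?thesis using that by blast
qed

lemma exp_integral_positive:
  fixes f :: "'j::topological_space \<Rightarrow> real"
  assumes "compact (UNIV :: 'j set)" and \<nu>: "borel_probability \<nu>" and "continuous_on UNIV f"
  shows "(\<integral>j. exp (f j) \<partial>\<nu>) > 0"
proof -
  interpret prob_space \<nu> using \<nu> by (simp add: borel_probability_def)
  obtain M where M: "\<And>x. \<bar>f x\<bar> \<le> M" using compact_continuous_bounded[OF assms(1,3)] by metis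
  have "(\<integral>j. exp (- M) \<partial>\<nu>) \<le> (\<integral>j. exp (f j) \<partial>\<nu>)"
    using M by (intro integral_mono borel_probability_integrable[OF \<nu> assms(1)] continuous_on_exp assms(3))
      (auto simp: abs_le_iff minus_le_iff)
  then show ?thesis by (simp add: prob_space) (meson exp_gt_zero less_le_trans)
qed

lemma eventually_ln_over_small:
  fixes \<kappa> e :: real
  assumes "e > 0"
  shows "\<forall>\<^sub>F \<beta> in at_top. \<bar>ln \<kappa> / \<beta>\<bar> < e"
proof -
  have "((\<lambda>\<beta>. ln \<kappa> / \<beta>) \<longlongrightarrow> 0) at_top" by (intro tendsto_divide_0[OF tendsto_const] filterlim_at_top_imp_at_infinity filterlim_ident)
  then show ?thesis using assms by (auto simp: tendsto_iff dist_real_def)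
qed

text \<open>
  As \<open>\<beta>\<close> grows, the integral of \<open>exp (\<beta> g)\<close> concentrates where \<open>g\<close> is largest.  The limit is uniform in
  the parameter \<open>x\<close>: equicontinuity makes \<open>G\<close> almost maximal on a ball whose radius does not depend on
  \<open>x\<close>, and a measure of full support on a compact space gives all balls of that radius a mass bounded
  away from zero.
\<close>

lemma laplace_uniform_limit:
  fixes G :: "'j::metric_space \<times> 'x::metric_space \<Rightarrow> real"
  assumes cJ: "compact (UNIV :: 'j set)" and cX: "compact (UNIV :: 'x set)"
    and \<nu>: "borel_probability \<nu>" and supp: "measure_support \<nu> = UNIV"
    and G: "continuous_on UNIV G" and H: "\<And>\<beta>. \<beta> > 0 \<Longrightarrow> continuous_on UNIV (H \<beta>)"
    and lim: "uniform_limit UNIV H G at_top"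
  shows "uniform_limit UNIV (\<lambda>\<beta> x. 1 / \<beta> * ln (\<integral>j. exp (\<beta> * H \<beta> (j, x)) \<partial>\<nu>))
           (\<lambda>x. SUP j. G (j, x)) at_top"
  unfolding uniform_limit_iff
proof (intro allI impI)
  interpret prob_space \<nu> using \<nu> by (simp add: borel_probability_def)
  have sets: "ball j r \<in> sets \<nu>" for j r using \<nu> by (simp add: borel_probability_def)
  fix e :: real assume "e > 0"
  \<comment> \<open>The lower bound loses \<open>e'\<close> to the choice of \<open>i\<close>, to the variation of \<open>G\<close> on the ball, to the distance
    of \<open>H\<close> from \<open>G\<close> and to the mass \<open>\<kappa>\<close> of the ball.\<close>
  define e' where "e' = e / 5"
  have "e' > 0" using \<open>e > 0\<close> by (simp add: e'_def)
  obtain d where d: "d > 0" "\<And>i j x. dist i j < d \<Longrightarrow> \<bar>G (i, x) - G (j, x)\<bar> < e'"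
    using compact_uniform_modulus[OF cJ cX G \<open>e' > 0\<close>] by metis
  obtain \<kappa> where \<kappa>: "\<kappa> > 0" "\<And>j. measure \<nu> (ball j d) \<ge> \<kappa>"
    using ball_measure_lower_bound[OF cJ \<nu> supp \<open>d > 0\<close>] by metis
  have "\<forall>\<^sub>F \<beta> in at_top. \<forall>z\<in>UNIV. dist (H \<beta> z) (G z) < e'"
    using lim \<open>e' > 0\<close> unfolding uniform_limit_iff by blast
  moreover have "\<forall>\<^sub>F \<beta> in at_top. \<bar>ln \<kappa> / \<beta>\<bar> < e'" by (rule eventually_ln_over_small) fact
  ultimately show "\<forall>\<^sub>F \<beta> in at_top. \<forall>x\<in>UNIV.
      dist (1 / \<beta> * ln (\<integral>j. exp (\<beta> * H \<beta> (j, x)) \<partial>\<nu>)) (SUP j. G (j, x)) < e"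
    using eventually_gt_at_top[of 0]
  proof eventually_elim
    case (elim \<beta>)
    then have "\<beta> > 0" and close: "\<And>z. \<bar>H \<beta> z - G z\<bar> < e'" and ln: "\<bar>ln \<kappa> / \<beta>\<bar> < e'"
      by (auto simp: dist_real_def)
    show ?case
    proof
      fix x
      define s where "s = (SUP j. G (j, x))"
      define Z where "Z = (\<integral>j. exp (\<beta> * H \<beta> (j, x)) \<partial>\<nu>)"
      have bdd: "bdd_above (range (\<lambda>j. G (j, x)))" by (rule bdd_above_section[OF cJ cX G])
      have cont: "continuous_on UNIV (\<lambda>j. \<beta> * H \<beta> (j, x))"
        using continuous_on_section[OF H[OF \<open>\<beta> > 0\<close>]] by (intro continuous_intros)
      have int: "integrable \<nu> (\<lambda>j. exp (\<beta> * H \<beta> (j, x)))"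
        using cont by (intro borel_probability_integrable[OF \<nu> cJ] continuous_on_exp)
      have "Z > 0" unfolding Z_def by (rule exp_integral_positive[OF cJ \<nu> cont])
      have "H \<beta> (j, x) \<le> s + e'" for j
        using close[of "(j, x)"] cSUP_upper[OF UNIV_I bdd, of j] unfolding s_def by linarith
      then have "Z \<le> (\<integral>j. exp (\<beta> * (s + e')) \<partial>\<nu>)"
        unfolding Z_def using \<open>\<beta> > 0\<close> int by (intro integral_mono) auto
      then have "ln Z \<le> \<beta> * (s + e')"
        using \<open>Z > 0\<close> by (simp add: prob_space ln_le_cancel_iff[symmetric] del: ln_le_cancel_iff)
      then have upper: "1 / \<beta> * ln Z \<le> s + e'" using \<open>\<beta> > 0\<close> by (simp add: field_simps)
      obtain i where i: "s - e' < G (i, x)"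
        using less_cSUP_iff[of UNIV "\<lambda>j. G (j, x)" "s - e'"] bdd \<open>e' > 0\<close> unfolding s_def by auto
      have near: "s - 3 * e' \<le> H \<beta> (j, x)" if "j \<in> ball i d" for j
        using close[of "(j, x)"] d(2)[of i j x] i that by auto
      have "\<kappa> * exp (\<beta> * (s - 3 * e')) \<le> measure \<nu> (ball i d) * exp (\<beta> * (s - 3 * e'))"
        using \<kappa>(2) by simp
      also have "\<dots> = (\<integral>j. exp (\<beta> * (s - 3 * e')) * indicator (ball i d) j \<partial>\<nu>)"
        using sets by (simp add: borel_probability_space[OF \<nu>])
      also have "\<dots> \<le> Z"
        unfolding Z_def
      proof (rule integral_mono[OF _ int])
        show "integrable \<nu> (\<lambda>j. exp (\<beta> * (s - 3 * e')) * indicator (ball i d) j)"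
          using sets by (intro integrable_mult_right integrable_real_indicator) (auto simp: less_top[symmetric])
        show "exp (\<beta> * (s - 3 * e')) * indicator (ball i d) j \<le> exp (\<beta> * H \<beta> (j, x))" for j
          using near[of j] \<open>\<beta> > 0\<close> by (auto simp: indicator_def)
      qed
      finally have "ln (\<kappa> * exp (\<beta> * (s - 3 * e'))) \<le> ln Z"
        using \<kappa>(1) \<open>Z > 0\<close> by (subst ln_le_cancel_iff) auto
      then have "ln \<kappa> + \<beta> * (s - 3 * e') \<le> ln Z" using \<kappa>(1) by (simp add: ln_mult)
      then have "(ln \<kappa> + \<beta> * (s - 3 * e')) / \<beta> \<le> ln Z / \<beta>" using \<open>\<beta> > 0\<close> by (intro divide_right_mono) auto
      then have "ln \<kappa> / \<beta> + (s - 3 * e') \<le> 1 / \<beta> * ln Z" using \<open>\<beta> > 0\<close> by (simp add: add_divide_distrib)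
      then have "\<bar>1 / \<beta> * ln Z - s\<bar> < e" using upper ln \<open>e > 0\<close> unfolding e'_def by linarith
      then show "dist (1 / \<beta> * ln (\<integral>j. exp (\<beta> * H \<beta> (j, x)) \<partial>\<nu>)) (SUP j. G (j, x)) < e"
        by (simp add: dist_real_def Z_def s_def)
    qed
  qed
qed


section \<open>Max-plus integrals and Varadhan's lemma\<close>

lemma ext_ln_less_imp:
  assumes "\<beta> > 0" and "p \<ge> 0" and "ereal (1 / \<beta>) * ext_ln p < ereal c"
  shows "p \<le> exp (\<beta> * c)"
proof (cases "p = 0")
  case False
  then have "1 / \<beta> * ln p < c" "p > 0" using assms by (auto simp: ext_ln_def)
  then have "ln p < \<beta> * c" using assms(1) by (simp add: field_simps)
  then show ?thesis using \<open>p > 0\<close> by (metis exp_less_cancel_iff exp_ln less_imp_le)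
qed simp

lemma less_ext_ln_imp:
  assumes "\<beta> > 0" and "p \<ge> 0" and "ereal c < ereal (1 / \<beta>) * ext_ln p"
  shows "exp (\<beta> * c) \<le> p"
proof (cases "p = 0")
  case True
  then show ?thesis using assms by (simp add: ext_ln_def)
next
  case False
  then have "c < 1 / \<beta> * ln p" "p > 0" using assms by (auto simp: ext_ln_def)
  then have "\<beta> * c < ln p" using assms(1) by (simp add: field_simps)
  then show ?thesis using \<open>p > 0\<close> by (metis exp_less_cancel_iff exp_ln less_imp_le)
qed

text \<open>
  The supremum is finite for bounded \<open>f\<close> and \<open>sup l = 0\<close>, the only case of interest, so that the
  conversion to a real number loses nothing there.
\<close>

definition maxplus_integral :: "('x \<Rightarrow> ereal) \<Rightarrow> ('x \<Rightarrow> real) \<Rightarrow> real" where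
  "maxplus_integral l f = real_of_ereal (SUP x. l x + ereal (f x))"

lemma ereal_maxplus_integral:
  assumes "(SUP x. l x) = 0" and "\<And>x. \<bar>f x\<bar> \<le> M"
  shows "ereal (maxplus_integral l f) = (SUP x. l x + ereal (f x))"
proof -
  have "l x \<le> 0" for x using assms(1) by (metis SUP_upper UNIV_I)
  then have "l x + ereal (f x) \<le> ereal M" for x
    using add_mono[of "l x" 0 "ereal (f x)" "ereal M"] assms(2)[of x] by (auto simp: abs_le_iff)
  then have "(SUP x. l x + ereal (f x)) \<le> ereal M" by (intro SUP_least)
  moreover obtain x where x: "-1 < l x"
    using assms(1) less_SUP_iff[of "-1" l UNIV] by auto
  have "ereal (-1 - M) \<le> l x + ereal (f x)"
    using x assms(2)[of x] add_mono[of "-1" "l x" "ereal (- M)" "ereal (f x)"]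
    by (auto simp: abs_le_iff one_ereal_def minus_le_iff)
  then have "ereal (-1 - M) \<le> (SUP x. l x + ereal (f x))" by (meson SUP_upper2 UNIV_I)
  ultimately show ?thesis unfolding maxplus_integral_def
    by (intro ereal_real') (auto simp: abs_ereal_ge0 not_le)
qed

lemma maxplus_integral_upper:
  assumes "(SUP x. l x) = 0" and "\<And>x. \<bar>f x\<bar> \<le> M"
  shows "l x \<le> ereal (maxplus_integral l f - f x)"
proof -
  have "l x + ereal (f x) \<le> ereal (maxplus_integral l f)"
    unfolding ereal_maxplus_integral[OF assms] by (rule SUP_upper) simp
  then show ?thesis by (cases "l x") auto
qed

lemma idempotent_probability_maxplus_integral:
  fixes l :: "'x::metric_space \<Rightarrow> ereal"
  assumes cX: "compact (UNIV :: 'x set)" and l: "(SUP x. l x) = 0"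
  shows "idempotent_probability (maxplus_integral l)"
proof -
  have eq: "ereal (maxplus_integral l f) = (SUP x. l x + ereal (f x))" if "continuous_on UNIV f" for f
    using compact_continuous_bounded[OF cX that] ereal_maxplus_integral[OF l] by metis
  have "maxplus_integral l (\<lambda>x. a + f x) = a + maxplus_integral l f" if "continuous_on UNIV f" for a f
  proof -
    have "ereal (maxplus_integral l (\<lambda>x. a + f x)) = (SUP x. l x + ereal (a + f x))"
      using that by (intro eq continuous_intros)
    also have "\<dots> = (SUP x. (l x + ereal (f x)) + ereal a)" by (simp add: add.assoc add.commute[of a])
    also have "\<dots> = ereal (maxplus_integral l f) + ereal a"
      unfolding eq[OF that] by (intro SUP_ereal_add_left) auto
    finally show ?thesis by simp
  qed
  moreover have "maxplus_integral l (\<lambda>x. max (f x) (g x)) = max (maxplus_integral l f) (maxplus_integral l g)"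
    if "continuous_on UNIV f" "continuous_on UNIV g" for f g
  proof -
    have "l x + ereal (max (f x) (g x)) = sup (l x + ereal (f x)) (l x + ereal (g x))" for x
      by (cases "l x") (auto simp: max_def sup_max)
    then have "ereal (maxplus_integral l (\<lambda>x. max (f x) (g x)))
        = (SUP x. sup (l x + ereal (f x)) (l x + ereal (g x)))"
      using that by (subst eq) (auto intro!: continuous_intros)
    also have "\<dots> = sup (ereal (maxplus_integral l f)) (ereal (maxplus_integral l g))"
      unfolding eq[OF that(1)] eq[OF that(2)] by (rule SUP_sup_distrib[symmetric]) auto
    finally show ?thesis by (simp add: sup_max max_def split: if_splits)
  qed
  moreover have "maxplus_integral l (\<lambda>x. 0) = 0" using l by (simp add: maxplus_integral_def)
  ultimately show ?thesis unfolding idempotent_probability_def by blast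
qed

text \<open>The whole space is closed and has mass one, so the upper large deviation bound there reads \<open>0 \<le> - inf I\<close>.\<close>

lemma large_deviation_rate_INF:
  assumes ldp: "large_deviation_principle \<rho> I" and \<rho>: "\<And>\<beta>. \<beta> > 0 \<Longrightarrow> borel_probability (\<rho> \<beta>)"
  shows "(SUP x. - I x) = 0"
proof -
  have "Limsup at_top (\<lambda>\<beta>. ereal (1 / \<beta>) * ext_ln (measure (\<rho> \<beta>) UNIV)) \<le> - (INF x. I x)"
    using ldp unfolding large_deviation_principle_def by simp
  moreover have "\<forall>\<^sub>F \<beta> in at_top. ereal (1 / \<beta>) * ext_ln (measure (\<rho> \<beta>) UNIV) = 0"
    using eventually_gt_at_top[of 0]
  proof eventually_elim
    case (elim \<beta>)
    interpret prob_space "\<rho> \<beta>" using \<rho>[OF elim] by (simp add: borel_probability_def)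
    show ?case using prob_space borel_probability_space[OF \<rho>[OF elim]] by (simp add: ext_ln_def)
  qed
  then have "Limsup at_top (\<lambda>\<beta>. ereal (1 / \<beta>) * ext_ln (measure (\<rho> \<beta>) UNIV)) = 0"
    by (intro lim_imp_Limsup tendsto_eventually) auto
  ultimately have "0 \<le> (SUP x. - I x)" by (simp add: ereal_SUP_uminus_eq)
  moreover have "(SUP x. - I x) \<le> 0"
    using ldp unfolding large_deviation_principle_def by (intro SUP_least) auto
  ultimately show ?thesis by (rule antisym[rotated])
qed

lemma large_deviation_rate_usc:
  assumes "large_deviation_principle \<rho> I"
  shows "upper_semicontinuous (\<lambda>x. - I x)"
  using assms unfolding large_deviation_principle_def lower_semicontinuous_def upper_semicontinuous_def
  by (simp add: ereal_Limsup_uminus)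

text \<open>
  The upper bound cuts the values of \<open>F\<close> into finitely many slices: where \<open>F\<close> lies between the levels
  \<open>a\<close> and \<open>a + \<epsilon>\<close>, the integrand is at most \<open>exp (\<beta> (a + \<epsilon>))\<close>, and the closed set \<open>{F \<ge> a}\<close> has mass
  at most about \<open>exp (- \<beta> inf I)\<close>.  The lower bound only looks at a neighbourhood of one almost optimal
  point.
\<close>

lemma varadhan:
  fixes F :: "'x::metric_space \<Rightarrow> real" and I :: "'x \<Rightarrow> ereal"
  assumes cX: "compact (UNIV :: 'x set)"
    and ldp: "large_deviation_principle \<rho> I" and \<rho>: "\<And>\<beta>. \<beta> > 0 \<Longrightarrow> borel_probability (\<rho> \<beta>)"
    and F: "continuous_on UNIV F" and H: "\<And>\<beta>. \<beta> > 0 \<Longrightarrow> continuous_on UNIV (H \<beta>)"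
    and lim: "uniform_limit UNIV H F at_top"
  shows "((\<lambda>\<beta>. 1 / \<beta> * ln (\<integral>x. exp (\<beta> * H \<beta> x) \<partial>\<rho> \<beta>)) \<longlongrightarrow> maxplus_integral (\<lambda>x. - I x) F) at_top"
  unfolding tendsto_iff
proof (intro allI impI)
  fix e' :: real assume "e' > 0"
  \<comment> \<open>The upper bound loses \<open>e\<close> to the mesh of the levels, to the distance of \<open>H\<close> from \<open>F\<close>, to the large
    deviation estimate and to the number of levels; the lower bound loses less.\<close>
  define e where "e = e' / 6"
  have "e > 0" using \<open>e' > 0\<close> by (simp add: e_def)
  define s where "s = maxplus_integral (\<lambda>x. - I x) F"
  obtain M where M: "M > 0" "\<And>x. \<bar>F x\<bar> \<le> M" using compact_continuous_bounded[OF cX F] by metis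
  have SUPI: "(SUP x. - I x) = 0" by (rule large_deviation_rate_INF[OF ldp \<rho>])
  have I_le: "- I x \<le> ereal (s - F x)" for x
    unfolding s_def by (rule maxplus_integral_upper[OF SUPI M(2)])
  \<comment> \<open>Levels \<open>a k\<close>, for \<open>k < N\<close>, that cover the range of \<open>F\<close> with mesh \<open>e\<close>.\<close>
  define a where "a k = - M + real k * e" for k
  obtain N :: nat where N: "2 * M / e < real N" using reals_Archimedean2 by blast
  have cover: "\<exists>k<N. a k \<le> F x \<and> F x \<le> a k + e" for x
  proof (intro exI[of _ "nat \<lfloor>(F x + M) / e\<rfloor>"] conjI)
    have ge: "0 \<le> (F x + M) / e" using M(2)[of x] \<open>e > 0\<close> by (auto simp: abs_le_iff)
    have "(F x + M) / e \<le> 2 * M / e" using M(2)[of x] \<open>e > 0\<close> by (intro divide_right_mono) (auto simp: abs_le_iff)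
    then show "nat \<lfloor>(F x + M) / e\<rfloor> < N" using N ge by linarith
    have r: "real (nat \<lfloor>(F x + M) / e\<rfloor>) = of_int \<lfloor>(F x + M) / e\<rfloor>" using ge by simp
    have "of_int \<lfloor>(F x + M) / e\<rfloor> * e \<le> (F x + M) / e * e" using \<open>e > 0\<close> by (intro mult_right_mono) auto
    then show "a (nat \<lfloor>(F x + M) / e\<rfloor>) \<le> F x" unfolding a_def r using \<open>e > 0\<close> by simp
    have "(F x + M) / e * e \<le> (of_int \<lfloor>(F x + M) / e\<rfloor> + 1) * e"
      using \<open>e > 0\<close> by (intro mult_right_mono) (linarith, simp)
    moreover have "(F x + M) / e * e = F x + M" using \<open>e > 0\<close> by simp
    ultimately show "F x \<le> a (nat \<lfloor>(F x + M) / e\<rfloor>) + e" unfolding a_def r distrib_right by linarith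
  qed
  have "N > 0" using cover by (metis gr_zeroI not_less_zero)
  define C where "C k = {x. a k \<le> F x}" for k
  have "closed (C k)" for k unfolding C_def by (intro closed_Collect_le continuous_on_const F)
  then have "Limsup at_top (\<lambda>\<beta>. ereal (1 / \<beta>) * ext_ln (measure (\<rho> \<beta>) (C k))) \<le> - (INF x\<in>C k. I x)" for k
    using ldp unfolding large_deviation_principle_def by blast
  moreover have "- (INF x\<in>C k. I x) < ereal (s - a k + e)" for k
  proof -
    have "- I x \<le> ereal (s - a k)" if "x \<in> C k" for x
      using I_le[of x] that unfolding C_def by (elim order_trans) auto
    then have "- (INF x\<in>C k. I x) \<le> ereal (s - a k)"
      by (simp add: ereal_SUP_uminus_eq[symmetric] SUP_le_iff)
    also have "\<dots> < ereal (s - a k + e)" using \<open>e > 0\<close> by simp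
    finally show ?thesis .
  qed
  ultimately have "\<forall>\<^sub>F \<beta> in at_top. ereal (1 / \<beta>) * ext_ln (measure (\<rho> \<beta>) (C k)) < ereal (s - a k + e)" for k
    by (intro Limsup_lessD) (rule le_less_trans)
  then have slices: "\<forall>\<^sub>F \<beta> in at_top. \<forall>k\<in>{..<N}. ereal (1 / \<beta>) * ext_ln (measure (\<rho> \<beta>) (C k)) < ereal (s - a k + e)"
    by (intro eventually_ball_finite) auto
  have "ereal (s - e) < ereal s" using \<open>e > 0\<close> by simp
  also have "ereal s = (SUP x. - I x + ereal (F x))"
    unfolding s_def by (rule ereal_maxplus_integral[OF SUPI M(2)])
  finally have "ereal (s - e) < (SUP x. - I x + ereal (F x))" .
  then obtain x0 where x0: "ereal (s - e) < - I x0 + ereal (F x0)" unfolding less_SUP_iff by blast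
  then have "ereal (s - e - F x0) < - I x0" by (cases "I x0") auto
  define U where "U = {x. F x0 - e < F x}"
  have "open U" unfolding U_def by (intro open_Collect_less continuous_on_const F)
  have "x0 \<in> U" using \<open>e > 0\<close> by (simp add: U_def)
  then have "- I x0 \<le> - (INF x\<in>U. I x)" by (simp add: INF_lower)
  also have "\<dots> \<le> Liminf at_top (\<lambda>\<beta>. ereal (1 / \<beta>) * ext_ln (measure (\<rho> \<beta>) U))"
    using ldp \<open>open U\<close> unfolding large_deviation_principle_def by blast
  finally have lower: "\<forall>\<^sub>F \<beta> in at_top. ereal (s - e - F x0) < ereal (1 / \<beta>) * ext_ln (measure (\<rho> \<beta>) U)"
    using \<open>ereal (s - e - F x0) < - I x0\<close> by (intro less_LiminfD) (rule less_le_trans)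
  have close: "\<forall>\<^sub>F \<beta> in at_top. \<forall>x\<in>UNIV. dist (H \<beta> x) (F x) < e"
    using lim \<open>e > 0\<close> unfolding uniform_limit_iff by blast
  have small: "\<forall>\<^sub>F \<beta> in at_top. \<bar>ln (real N) / \<beta>\<bar> < e" by (rule eventually_ln_over_small) fact
  show "\<forall>\<^sub>F \<beta> in at_top. dist (1 / \<beta> * ln (\<integral>x. exp (\<beta> * H \<beta> x) \<partial>\<rho> \<beta>)) (maxplus_integral (\<lambda>x. - I x) F) < e'"
    using slices lower close small eventually_gt_at_top[of 0]
  proof eventually_elim
    case (elim \<beta>)
    then have "\<beta> > 0" by simp
    interpret prob_space "\<rho> \<beta>" using \<rho>[OF \<open>\<beta> > 0\<close>] by (simp add: borel_probability_def)
    have sets: "sets (\<rho> \<beta>) = sets borel" using \<rho>[OF \<open>\<beta> > 0\<close>] by (simp add: borel_probability_def)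
    have setC: "C k \<in> sets (\<rho> \<beta>)" for k unfolding sets using \<open>closed (C k)\<close> by simp
    have setU: "U \<in> sets (\<rho> \<beta>)" unfolding sets using \<open>open U\<close> by simp
    have near: "\<bar>H \<beta> x - F x\<bar> < e" for x using elim by (auto simp: dist_real_def)
    define Z where "Z = (\<integral>x. exp (\<beta> * H \<beta> x) \<partial>\<rho> \<beta>)"
    have cont: "continuous_on UNIV (\<lambda>x. \<beta> * H \<beta> x)" using H[OF \<open>\<beta> > 0\<close>] by (intro continuous_intros)
    have "Z > 0" unfolding Z_def by (rule exp_integral_positive[OF cX \<rho>[OF \<open>\<beta> > 0\<close>] cont])
    have int: "integrable (\<rho> \<beta>) (\<lambda>x. exp (\<beta> * H \<beta> x))"
      using cont by (intro borel_probability_integrable[OF \<rho>[OF \<open>\<beta> > 0\<close>] cX] continuous_on_exp)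
    have "Z \<le> (\<integral>x. (\<Sum>k<N. exp (\<beta> * (a k + 2 * e)) * indicator (C k) x) \<partial>\<rho> \<beta>)"
      unfolding Z_def
    proof (rule integral_mono[OF int])
      show "integrable (\<rho> \<beta>) (\<lambda>x. \<Sum>k<N. exp (\<beta> * (a k + 2 * e)) * indicator (C k) x)"
        using setC by (intro Bochner_Integration.integrable_sum integrable_mult_right integrable_real_indicator)
          (auto simp: less_top[symmetric])
      fix x
      obtain k where k: "k < N" "a k \<le> F x" "F x \<le> a k + e" using cover by blast
      have "exp (\<beta> * H \<beta> x) \<le> exp (\<beta> * (a k + 2 * e)) * indicator (C k) x"
        using k near[of x] \<open>\<beta> > 0\<close> by (simp add: C_def)
      also have "\<dots> \<le> (\<Sum>k<N. exp (\<beta> * (a k + 2 * e)) * indicator (C k) x)"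
        using k(1) by (intro member_le_sum) auto
      finally show "exp (\<beta> * H \<beta> x) \<le> (\<Sum>k<N. exp (\<beta> * (a k + 2 * e)) * indicator (C k) x)" .
    qed
    also have "\<dots> = (\<Sum>k<N. exp (\<beta> * (a k + 2 * e)) * prob (C k))"
      using setC by (subst Bochner_Integration.integral_sum)
        (auto simp: less_top[symmetric] borel_probability_space[OF \<rho>[OF \<open>\<beta> > 0\<close>]])
    also have "\<dots> \<le> (\<Sum>k<N. exp (\<beta> * (s + 3 * e)))"
    proof (rule sum_mono)
      fix k assume "k \<in> {..<N}"
      then have "prob (C k) \<le> exp (\<beta> * (s - a k + e))"
        using elim(1) by (intro ext_ln_less_imp[OF \<open>\<beta> > 0\<close> measure_nonneg]) blast
      then have "exp (\<beta> * (a k + 2 * e)) * prob (C k) \<le> exp (\<beta> * (a k + 2 * e)) * exp (\<beta> * (s - a k + e))" by simp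
      also have "\<dots> = exp (\<beta> * (s + 3 * e))" by (simp add: exp_add[symmetric] algebra_simps)
      finally show "exp (\<beta> * (a k + 2 * e)) * prob (C k) \<le> exp (\<beta> * (s + 3 * e))" .
    qed
    finally have "Z \<le> real N * exp (\<beta> * (s + 3 * e))" by simp
    then have "ln Z \<le> ln (real N * exp (\<beta> * (s + 3 * e)))" using \<open>Z > 0\<close> \<open>N > 0\<close> by (subst ln_le_cancel_iff) auto
    then have "ln Z \<le> ln (real N) + \<beta> * (s + 3 * e)" using \<open>N > 0\<close> by (simp add: ln_mult)
    then have "ln Z / \<beta> \<le> (ln (real N) + \<beta> * (s + 3 * e)) / \<beta>" using \<open>\<beta> > 0\<close> by (intro divide_right_mono) auto
    then have upper: "1 / \<beta> * ln Z \<le> ln (real N) / \<beta> + (s + 3 * e)" using \<open>\<beta> > 0\<close> by (simp add: add_divide_distrib)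
    have "exp (\<beta> * (s - 3 * e)) = exp (\<beta> * (F x0 - 2 * e)) * exp (\<beta> * (s - e - F x0))"
      by (simp add: exp_add[symmetric] algebra_simps)
    also have "\<dots> \<le> exp (\<beta> * (F x0 - 2 * e)) * prob U"
      using less_ext_ln_imp[OF \<open>\<beta> > 0\<close> measure_nonneg elim(2)] by simp
    also have "\<dots> = (\<integral>x. exp (\<beta> * (F x0 - 2 * e)) * indicator U x \<partial>\<rho> \<beta>)"
      by (simp add: borel_probability_space[OF \<rho>[OF \<open>\<beta> > 0\<close>]])
    also have "\<dots> \<le> Z" unfolding Z_def
    proof (rule integral_mono[OF _ int])
      show "integrable (\<rho> \<beta>) (\<lambda>x. exp (\<beta> * (F x0 - 2 * e)) * indicator U x)"
        using setU by (intro integrable_mult_right integrable_real_indicator) (auto simp: less_top[symmetric])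
      show "exp (\<beta> * (F x0 - 2 * e)) * indicator U x \<le> exp (\<beta> * H \<beta> x)" for x
        using near[of x] \<open>\<beta> > 0\<close> by (auto simp: indicator_def U_def)
    qed
    finally have "\<beta> * (s - 3 * e) \<le> ln Z" using \<open>Z > 0\<close> by (simp add: ln_ge_iff)
    then have "s - 3 * e \<le> 1 / \<beta> * ln Z" using \<open>\<beta> > 0\<close> by (simp add: field_simps)
    then have "\<bar>1 / \<beta> * ln Z - s\<bar> < e'" using upper elim(4) \<open>e' > 0\<close> unfolding e_def by linarith
    then show ?case by (simp add: dist_real_def Z_def s_def)
  qed
qed


section \<open>Semicontinuity and the Mane potential\<close>

lemma upper_semicontinuous_eventually:
  assumes "upper_semicontinuous l" and "l x < c"
  shows "\<forall>\<^sub>F y in nhds x. l y < c"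
  using assms Limsup_lessD[of "at x" l c]
  unfolding upper_semicontinuous_def eventually_nhds_conv_at by (meson le_less_trans)

lemma upper_semicontinuous_sequentially:
  fixes c :: "nat \<Rightarrow> real"
  assumes usc: "upper_semicontinuous l" and X: "X \<longlonglongrightarrow> x" and c: "c \<longlonglongrightarrow> c0"
    and le: "\<And>n. ereal (c n) \<le> l (X n)"
  shows "ereal c0 \<le> l x"
proof (rule ccontr)
  assume "\<not> ereal c0 \<le> l x"
  then obtain d where d: "l x < ereal d" "ereal d < ereal c0" using ereal_dense2 not_le by metis
  have "\<forall>\<^sub>F n in sequentially. l (X n) < ereal d"
    using upper_semicontinuous_eventually[OF usc d(1)] X unfolding filterlim_iff by blast
  moreover have "\<forall>\<^sub>F n in sequentially. d < c n" using c d(2) by (auto intro: order_tendstoD)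
  ultimately have "\<forall>\<^sub>F n in sequentially. False"
  proof eventually_elim
    case (elim n)
    then have "l (X n) < ereal (c n)" using less_trans[of "l (X n)" "ereal d" "ereal (c n)"] by simp
    then show ?case using le[of n] by simp
  qed
  then show False by simp
qed

lemma mane_sum_Nil: "mane_sum \<phi> B [] y = 0"
  by (simp add: mane_sum_def)

lemma mane_sum_Cons:
  "mane_sum \<phi> B (j # \<omega>) y = B (j, foldr \<phi> \<omega> y) - max_holonomic \<phi> B + mane_sum \<phi> B \<omega> y"
  unfolding mane_sum_def by (simp add: sum.lessThan_Suc_shift algebra_simps del: sum.lessThan_Suc)

lemma mane_eps_le_iff:
  "mane_eps \<phi> B e x y \<le> c \<longleftrightarrow>
     (\<forall>\<omega>. \<omega> \<noteq> [] \<longrightarrow> dist x (foldr \<phi> \<omega> y) < e \<longrightarrow> ereal (mane_sum \<phi> B \<omega> y) \<le> c)"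
  unfolding mane_eps_def SUP_le_iff by (auto simp: Suc_le_eq)

lemma mane_sum_le_mane_eps:
  "\<omega> \<noteq> [] \<Longrightarrow> dist x (foldr \<phi> \<omega> y) < e \<Longrightarrow> ereal (mane_sum \<phi> B \<omega> y) \<le> mane_eps \<phi> B e x y"
  by (rule mane_eps_le_iff[THEN iffD1, OF order_refl, rule_format])

lemma mane_eps_mono: "e \<le> e' \<Longrightarrow> mane_eps \<phi> B e x y \<le> mane_eps \<phi> B e' x y"
  unfolding mane_eps_le_iff[of _ _ e] by (auto intro!: mane_sum_le_mane_eps)

text \<open>A smaller \<open>\<epsilon>\<close> admits fewer words, so that the limit is a monotone one.\<close>

lemma mane_potential_eq_INF: "mane_potential \<phi> B x y = (INF e\<in>{0<..}. mane_eps \<phi> B e x y)"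
proof -
  let ?S = "\<lambda>e. mane_eps \<phi> B e x y"
  have "(?S \<longlongrightarrow> (INF e\<in>{0<..}. ?S e)) (at_right 0)"
  proof (rule order_tendstoI)
    fix a assume a: "a < (INF e\<in>{0<..}. ?S e)"
    have "a < ?S e" if "e > 0" for e using a INF_lower[of e "{0<..}" ?S] that by (auto intro: less_le_trans)
    then show "\<forall>\<^sub>F e in at_right 0. a < ?S e" by (intro eventually_at_rightI[of 0 1]) auto
  next
    fix a assume "(INF e\<in>{0<..}. ?S e) < a"
    then obtain e0 where e0: "e0 > 0" "?S e0 < a" by (auto simp: INF_less_iff)
    have "?S e < a" if "e < e0" for e using mane_eps_mono[of e e0 \<phi> B x y] e0(2) that by (meson le_less_trans less_imp_le)
    then show "\<forall>\<^sub>F e in at_right 0. ?S e < a" using e0(1) by (intro eventually_at_rightI[of 0 e0]) auto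
  qed
  then show ?thesis unfolding mane_potential_def by (intro tendsto_Lim) auto
qed

lemma le_mane_potential_iff:
  "c \<le> mane_potential \<phi> B x y \<longleftrightarrow> (\<forall>e>0. c \<le> mane_eps \<phi> B e x y)"
  unfolding mane_potential_eq_INF le_INF_iff by auto

lemma mane_potential_geI:
  assumes "\<And>e. e > 0 \<Longrightarrow> \<exists>\<omega>. \<omega> \<noteq> [] \<and> dist x (foldr \<phi> \<omega> y) < e \<and> c - e \<le> mane_sum \<phi> B \<omega> y"
  shows "ereal c \<le> mane_potential \<phi> B x y"
  unfolding le_mane_potential_iff
proof (intro allI impI)
  fix e :: real assume "e > 0"
  have "ereal c \<le> mane_eps \<phi> B e x y + ereal \<eta>" if "\<eta> > 0" for \<eta>
  proof -
    define d where "d = min e \<eta>"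
    have d: "d > 0" "d \<le> e" "d \<le> \<eta>" using \<open>e > 0\<close> \<open>\<eta> > 0\<close> by (auto simp: d_def)
    obtain \<omega> where "\<omega> \<noteq> []" "dist x (foldr \<phi> \<omega> y) < d" "c - d \<le> mane_sum \<phi> B \<omega> y"
      using assms[OF d(1)] by blast
    then have \<omega>: "\<omega> \<noteq> []" "dist x (foldr \<phi> \<omega> y) < e" "c - \<eta> \<le> mane_sum \<phi> B \<omega> y" using d by auto
    have "ereal (mane_sum \<phi> B \<omega> y) \<le> mane_eps \<phi> B e x y"
      using \<omega>(1,2) by (rule mane_sum_le_mane_eps)
    then have "ereal (mane_sum \<phi> B \<omega> y) + ereal \<eta> \<le> mane_eps \<phi> B e x y + ereal \<eta>" by (rule add_right_mono)
    moreover have "ereal c \<le> ereal (mane_sum \<phi> B \<omega> y) + ereal \<eta>" using \<omega>(3) by (simp add: diff_le_eq)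
    ultimately show ?thesis by (metis order_trans)
  qed
  then show "ereal c \<le> mane_eps \<phi> B e x y" by (rule ereal_le_epsilon2[rule_format])
qed


section \<open>Contractive iterated function systems\<close>

locale contractive_ifs =
  fixes \<phi> :: "'j::metric_space \<Rightarrow> 'x::metric_space \<Rightarrow> 'x" and \<gamma> :: real
  assumes compact_X: "compact (UNIV :: 'x set)" and compact_J: "compact (UNIV :: 'j set)"
    and \<gamma>_pos: "0 < \<gamma>" and \<gamma>_less_1: "\<gamma> < 1"
    and contraction: "dist (\<phi> i x) (\<phi> j y) \<le> \<gamma> * (dist i j + dist x y)"
begin

lemma continuous_phi: "continuous_on UNIV (\<lambda>z. \<phi> (fst z) (snd z))"
proof -
  have "(2 * \<gamma>)-lipschitz_on UNIV (\<lambda>z. \<phi> (fst z) (snd z))"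
  proof (rule lipschitz_onI)
    fix z w :: "'j \<times> 'x"
    have "dist (\<phi> (fst z) (snd z)) (\<phi> (fst w) (snd w)) \<le> \<gamma> * (dist (fst z) (fst w) + dist (snd z) (snd w))"
      by (rule contraction)
    also have "\<dots> \<le> \<gamma> * (dist z w + dist z w)"
      using \<gamma>_pos by (intro mult_left_mono add_mono dist_fst_le dist_snd_le) auto
    finally show "dist (\<phi> (fst z) (snd z)) (\<phi> (fst w) (snd w)) \<le> 2 * \<gamma> * dist z w" by simp
  qed (use \<gamma>_pos in simp)
  then show ?thesis by (rule lipschitz_on_continuous_on)
qed

lemma continuous_comp_phi:
  fixes f :: "'x \<Rightarrow> real"
  assumes "continuous_on UNIV f"
  shows "continuous_on UNIV (\<lambda>z. f (\<phi> (fst z) (snd z)))"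
  by (rule continuous_on_compose2[OF assms continuous_phi]) auto

lemma dist_foldr_le: "dist (foldr \<phi> \<omega> y) (foldr \<phi> \<omega> z) \<le> \<gamma> ^ length \<omega> * dist y z"
proof (induction \<omega>)
  case (Cons j \<omega>)
  have "dist (foldr \<phi> (j # \<omega>) y) (foldr \<phi> (j # \<omega>) z) \<le> \<gamma> * dist (foldr \<phi> \<omega> y) (foldr \<phi> \<omega> z)"
    using contraction[of j _ j] by simp
  also have "\<dots> \<le> \<gamma> * (\<gamma> ^ length \<omega> * dist y z)" using \<gamma>_pos Cons by (intro mult_left_mono) auto
  finally show ?case by simp
qed simp

lemma sum_power_gamma_le: "(\<Sum>k<n. \<gamma> ^ k) \<le> 1 / (1 - \<gamma>)"
proof -
  have "(\<Sum>k<n. \<gamma> ^ k) \<le> (\<Sum>k. \<gamma> ^ k)"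
    using \<gamma>_pos \<gamma>_less_1 by (intro sum_le_suminf summable_geometric) auto
  then show ?thesis using \<gamma>_pos \<gamma>_less_1 by (simp add: suminf_geometric)
qed

text \<open>
  Two orbits driven by the same word approach each other geometrically, which bounds the difference
  of their sums independently of the length of the word.
\<close>

lemma mane_sum_distortion:
  assumes lip: "\<And>j x y. \<bar>B (j, x) - B (j, y)\<bar> \<le> C * dist x y" and "C \<ge> 0"
  shows "\<bar>mane_sum \<phi> B \<omega> y - mane_sum \<phi> B \<omega> z\<bar> \<le> C / (1 - \<gamma>) * dist y z"
proof -
  have "\<bar>mane_sum \<phi> B \<omega> y - mane_sum \<phi> B \<omega> z\<bar> \<le> C * (\<Sum>k<length \<omega>. \<gamma> ^ k) * dist y z"
  proof (induction \<omega>)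
    case (Cons j \<omega>)
    have "\<bar>B (j, foldr \<phi> \<omega> y) - B (j, foldr \<phi> \<omega> z)\<bar> \<le> C * dist (foldr \<phi> \<omega> y) (foldr \<phi> \<omega> z)" by (rule lip)
    also have "\<dots> \<le> C * (\<gamma> ^ length \<omega> * dist y z)" using \<open>C \<ge> 0\<close> dist_foldr_le by (intro mult_left_mono)
    finally show ?case using Cons unfolding mane_sum_Cons by (simp add: algebra_simps)
  qed (simp add: mane_sum_Nil)
  also have "\<dots> \<le> C * (1 / (1 - \<gamma>)) * dist y z"
    using \<open>C \<ge> 0\<close> by (intro mult_right_mono mult_left_mono sum_power_gamma_le) auto
  finally show ?thesis by simp
qed

end

section \<open>Invariant densities of max-plus systems\<close>

locale invariant_density = contractive_ifs \<phi> \<gamma>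
  for \<phi> :: "'j::metric_space \<Rightarrow> 'x::metric_space \<Rightarrow> 'x" and \<gamma> +
  fixes q :: "'j \<times> 'x \<Rightarrow> real" and C :: real and l :: "'x \<Rightarrow> ereal"
  assumes q_continuous: "continuous_on UNIV q"
    and q_lipschitz: "\<bar>q (j, x) - q (j, y)\<bar> \<le> C * dist x y" and C_nonneg: "C \<ge> 0"
    and q_nonpos: "q z \<le> 0" and max_holonomic_q: "max_holonomic \<phi> q = 0"
    and usc: "upper_semicontinuous l" and l_nonpos: "l x \<le> 0"
    and invariant: "continuous_on UNIV f \<Longrightarrow>
      (SUP x. l x + ereal (f x)) = (SUP x. l x + ereal (SUP j. q (j, x) + f (\<phi> j x)))"
begin

lemma bdd_above_weighted:
  assumes "continuous_on UNIV f"
  shows "bdd_above (range (\<lambda>j. q (j, x) + f (\<phi> j x)))"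
  using bdd_above_section[OF compact_J compact_X
      continuous_on_add[OF q_continuous continuous_comp_phi[OF assms]], of x] by simp

text \<open>
  Invariance is tested against the functions \<open>y \<mapsto> - K d(x, y)\<close>: for large \<open>K\<close> they see only values of
  the density near \<open>x\<close>, where upper semicontinuity controls it.
\<close>

lemma density_ge: "l z + ereal (q (j, z)) \<le> l (\<phi> j z)"
proof (rule ccontr)
  let ?x = "\<phi> j z"
  assume "\<not> l z + ereal (q (j, z)) \<le> l ?x"
  then obtain c where c: "l ?x < ereal c" "ereal c < l z + ereal (q (j, z))" using ereal_dense2 not_le by metis
  obtain \<delta> where \<delta>: "\<delta> > 0" "\<And>y. dist y ?x < \<delta> \<Longrightarrow> l y < ereal c"
    using upper_semicontinuous_eventually[OF usc c(1)] unfolding eventually_nhds_metric by blast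
  define f where "f y = - (\<bar>c\<bar> / \<delta>) * dist ?x y" for y
  have f: "continuous_on UNIV f" unfolding f_def by (intro continuous_intros)
  have "l y + ereal (f y) \<le> ereal c" for y
  proof (cases "dist y ?x < \<delta>")
    case True
    have "f y \<le> 0" using \<delta>(1) by (simp add: f_def)
    then have "l y + ereal (f y) \<le> ereal c + 0" using \<delta>(2)[OF True] by (intro add_mono) auto
    then show ?thesis by simp
  next
    case False
    then have "\<bar>c\<bar> / \<delta> * \<delta> \<le> \<bar>c\<bar> / \<delta> * dist ?x y" using \<delta>(1) by (intro mult_left_mono) (auto simp: dist_commute)
    then have "f y \<le> c" using \<delta>(1) by (simp add: f_def)
    then have "l y + ereal (f y) \<le> 0 + ereal c" using l_nonpos by (intro add_mono) auto
    then show ?thesis by simp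
  qed
  then have "(SUP y. l y + ereal (f y)) \<le> ereal c" by (intro SUP_least)
  moreover have "q (j, z) \<le> (SUP i. q (i, z) + f (\<phi> i z))"
    using cSUP_upper[OF UNIV_I bdd_above_weighted[OF f], of j z] by (simp add: f_def)
  then have "l z + ereal (q (j, z)) \<le> l z + ereal (SUP i. q (i, z) + f (\<phi> i z))" by (intro add_left_mono) simp
  then have "l z + ereal (q (j, z)) \<le> (SUP y. l y + ereal (f y))"
    unfolding invariant[OF f] by (rule order_trans) (rule SUP_upper, simp)
  ultimately show False using c(2) by simp
qed

text \<open>
  Tested against \<open>- n d(x, _)\<close>, the invariance yields almost optimal pairs \<open>(j, z)\<close> whose images are within
  a multiple of \<open>1/n\<close> of \<open>x\<close>.  A limit of such pairs is exactly optimal, by compactness and upper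
  semicontinuity.
\<close>

lemma density_attained:
  assumes "l x \<noteq> - \<infinity>"
  shows "\<exists>j z. \<phi> j z = x \<and> l z + ereal (q (j, z)) = l x"
proof -
  obtain r where r: "l x = ereal r" using assms l_nonpos[of x] by (cases "l x") auto
  then have "r \<le> 0" using l_nonpos[of x] by simp
  have "\<exists>j z. ereal (r - 1 / real (Suc n) + real n * dist x (\<phi> j z) - q (j, z)) \<le> l z" for n
  proof -
    define f where "f y = - real n * dist x y" for y
    have f: "continuous_on UNIV f" unfolding f_def by (intro continuous_intros)
    have "ereal (r - 1 / real (Suc n)) < l x + ereal (f x)" by (simp add: r f_def)
    also have "\<dots> \<le> (SUP y. l y + ereal (f y))" by (rule SUP_upper) simp
    finally have "ereal (r - 1 / real (Suc n)) < (SUP z. l z + ereal (SUP j. q (j, z) + f (\<phi> j z)))"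
      unfolding invariant[OF f] .
    then obtain z where z: "ereal (r - 1 / real (Suc n)) < l z + ereal (SUP j. q (j, z) + f (\<phi> j z))"
      unfolding less_SUP_iff by blast
    then obtain a where a: "l z = ereal a" using l_nonpos[of z] by (cases "l z") auto
    have "r - 1 / real (Suc n) - a < (SUP j. q (j, z) + f (\<phi> j z))" using z unfolding a by simp
    then obtain j where "r - 1 / real (Suc n) - a < q (j, z) + f (\<phi> j z)"
      using less_cSUP_iff[OF _ bdd_above_weighted[OF f]] by blast
    then show ?thesis using a by (intro exI[of _ j] exI[of _ z]) (simp add: f_def)
  qed
  then obtain J Z where JZ: "\<And>n. ereal (r - 1 / real (Suc n) + real n * dist x (\<phi> (J n) (Z n)) - q (J n, Z n)) \<le> l (Z n)"
    by metis
  obtain w s where s: "strict_mono s" and w: "((\<lambda>n. (J n, Z n)) \<circ> s) \<longlonglongrightarrow> w"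
    using compact_UNIV_Pair[OF compact_J compact_X] unfolding compact_def by blast
  obtain j z where "w = (j, z)" by (cases w)
  then have lim: "(\<lambda>n. (J (s n), Z (s n))) \<longlonglongrightarrow> (j, z)" using w by (simp add: o_def)
  have q_lim: "(\<lambda>n. q (J (s n), Z (s n))) \<longlonglongrightarrow> q (j, z)"
    using continuous_on_tendsto_compose[OF q_continuous lim] by simp
  have phi_lim: "(\<lambda>n. \<phi> (J (s n)) (Z (s n))) \<longlonglongrightarrow> \<phi> j z"
    using continuous_on_tendsto_compose[OF continuous_phi lim] by simp
  have inv_lim: "(\<lambda>n. 1 / real (Suc (s n))) \<longlonglongrightarrow> 0"
    using LIMSEQ_subseq_LIMSEQ[OF LIMSEQ_Suc[OF lim_1_over_n] s] by (simp add: o_def)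
  have "\<phi> j z = x"
  proof -
    \<comment> \<open>The factor \<open>2\<close> passes from \<open>n\<close> to \<open>n + 1\<close> in the denominator.\<close>
    have bound: "dist x (\<phi> (J n) (Z n)) \<le> (2 - r) * (1 / real (Suc n)) * 2" if "n > 0" for n
    proof -
      have "r - 1 / real (Suc n) + real n * dist x (\<phi> (J n) (Z n)) - q (J n, Z n) \<le> 0"
        using order_trans[OF JZ[of n] l_nonpos] by simp
      then have "real n * dist x (\<phi> (J n) (Z n)) \<le> 1 / real (Suc n) - r" using q_nonpos[of "(J n, Z n)"] by linarith
      also have "1 / real (Suc n) - r \<le> 1 - r" by simp
      finally have 1: "real n * dist x (\<phi> (J n) (Z n)) \<le> 1 - r" .
      have "real (Suc n) * dist x (\<phi> (J n) (Z n)) \<le> (2 * real n) * dist x (\<phi> (J n) (Z n))"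
        using that by (intro mult_right_mono) auto
      also have "\<dots> \<le> 2 * (1 - r)" using 1 by simp
      finally have "real (Suc n) * dist x (\<phi> (J n) (Z n)) \<le> 2 * (2 - r)" by simp
      then show ?thesis by (simp add: field_simps)
    qed
    have "(\<lambda>n. (2 - r) * (1 / real (Suc (s n))) * 2) \<longlonglongrightarrow> (2 - r) * 0 * 2"
      by (intro tendsto_intros inv_lim)
    moreover have "s n > 0" if "n > 0" for n using seq_suble[OF s, of n] that by simp
    then have "\<forall>\<^sub>F n in sequentially. dist x (\<phi> (J (s n)) (Z (s n))) \<le> (2 - r) * (1 / real (Suc (s n))) * 2"
      using bound by (intro eventually_sequentiallyI[of 1]) auto
    moreover have "(\<lambda>n. dist x (\<phi> (J (s n)) (Z (s n)))) \<longlonglongrightarrow> dist x (\<phi> j z)"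
      by (intro tendsto_intros phi_lim)
    ultimately have "dist x (\<phi> j z) \<le> (2 - r) * 0 * 2" by (intro tendsto_le[OF sequentially_bot]) auto
    then show ?thesis by simp
  qed
  moreover have "ereal (r - 0 - q (j, z)) \<le> l z"
  proof (rule upper_semicontinuous_sequentially[OF usc])
    show "(\<lambda>n. Z (s n)) \<longlonglongrightarrow> z" using tendsto_snd[OF lim] by simp
    show "(\<lambda>n. r - 1 / real (Suc (s n)) - q (J (s n), Z (s n))) \<longlonglongrightarrow> r - 0 - q (j, z)"
      by (intro tendsto_intros inv_lim q_lim)
    show "ereal (r - 1 / real (Suc (s n)) - q (J (s n), Z (s n))) \<le> l (Z (s n))" for n
      by (rule order_trans[OF _ JZ[of "s n"]]) simp
  qed
  then have "ereal r \<le> l z + ereal (q (j, z))" by (cases "l z") auto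
  ultimately show ?thesis using density_ge[of z j] r by (metis antisym)
qed

lemma density_ge_mane_sum: "ereal (mane_sum \<phi> q \<omega> z) + l z \<le> l (foldr \<phi> \<omega> z)"
proof (induction \<omega>)
  case (Cons j \<omega>)
  have "ereal (mane_sum \<phi> q (j # \<omega>) z) + l z = (ereal (mane_sum \<phi> q \<omega> z) + l z) + ereal (q (j, foldr \<phi> \<omega> z))"
    by (cases "l z") (auto simp: mane_sum_Cons max_holonomic_q)
  also have "\<dots> \<le> l (foldr \<phi> \<omega> z) + ereal (q (j, foldr \<phi> \<omega> z))" using Cons by (rule add_right_mono)
  also have "\<dots> \<le> l (\<phi> j (foldr \<phi> \<omega> z))" by (rule density_ge)
  finally show ?case by simp
qed (simp add: mane_sum_Nil)

lemma mane_sum_nonpos: "mane_sum \<phi> q \<omega> z \<le> 0"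
proof (induction \<omega>)
  case (Cons j \<omega>)
  then show ?case using q_nonpos[of "(j, foldr \<phi> \<omega> z)"] by (simp add: mane_sum_Cons max_holonomic_q)
qed (simp add: mane_sum_Nil)

lemma mane_potential_le: "mane_potential \<phi> q x z \<le> mane_eps \<phi> q e x z" if "e > 0"
  using le_mane_potential_iff[THEN iffD1, OF order_refl] that by blast

lemma mane_potential_nonpos: "mane_potential \<phi> q x z \<le> 0"
  by (rule order_trans[OF mane_potential_le[of 1]]) (auto simp: mane_eps_le_iff mane_sum_nonpos)

text \<open>Every word that carries \<open>z\<close> close to \<open>x\<close> ends where the density is hardly larger than at \<open>x\<close>.\<close>

lemma density_ge_mane_potential: "mane_potential \<phi> q x z + l z \<le> l x"
proof (rule ccontr)
  assume "\<not> mane_potential \<phi> q x z + l z \<le> l x"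
  then obtain c where c: "l x < ereal c" "ereal c < mane_potential \<phi> q x z + l z" using ereal_dense2 not_le by metis
  then obtain b where b: "l z = ereal b"
    using l_nonpos[of z] mane_potential_nonpos[of x z] by (cases "l z"; cases "mane_potential \<phi> q x z") auto
  obtain \<delta> where \<delta>: "\<delta> > 0" "\<And>y. dist y x < \<delta> \<Longrightarrow> l y < ereal c"
    using upper_semicontinuous_eventually[OF usc c(1)] unfolding eventually_nhds_metric by blast
  have "mane_eps \<phi> q \<delta> x z \<le> ereal (c - b)"
    unfolding mane_eps_le_iff
  proof (intro allI impI)
    fix \<omega> assume "dist x (foldr \<phi> \<omega> z) < \<delta>"
    then have "ereal (mane_sum \<phi> q \<omega> z) + l z < ereal c"
      using density_ge_mane_sum \<delta>(2) by (metis dist_commute le_less_trans)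
    then show "ereal (mane_sum \<phi> q \<omega> z) \<le> ereal (c - b)" unfolding b by simp
  qed
  then have "mane_potential \<phi> q x z \<le> ereal (c - b)" using mane_potential_le[OF \<delta>(1)] order_trans by blast
  then have "mane_potential \<phi> q x z + l z \<le> ereal (c - b) + ereal b" unfolding b by (rule add_right_mono)
  then show False using c(2) by simp
qed

text \<open>
  A backward orbit of optimal preimages, started at \<open>x\<close>, has weights that sum up to a finite total.
  Any accumulation point \<open>z\<close> of it lies in the Aubry set: orbit segments between two late visits near
  \<open>z\<close> almost close up and cost almost nothing, and by the distortion estimate the same words may be
  applied to \<open>z\<close> itself.  The segments from late visits near \<open>z\<close> to \<open>x\<close> show that \<open>z\<close> realises
  the density at \<open>x\<close>.
\<close>

lemma density_le_aubry:
  assumes "l x \<noteq> - \<infinity>"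
  shows "\<exists>z\<in>aubry_set \<phi> q. l x \<le> mane_potential \<phi> q x z + l z"
proof -
  obtain J Z where JZ: "\<And>y. l y \<noteq> - \<infinity> \<Longrightarrow> \<phi> (J y) (Z y) = y \<and> l (Z y) + ereal (q (J y, Z y)) = l y"
    using density_attained by metis
  define X where "X n = (Z ^^ n) x" for n
  have X_0: "X 0 = x" by (simp add: X_def)
  have X_Suc: "X (Suc n) = Z (X n)" for n by (simp add: X_def)
  have fin: "l (X n) \<noteq> - \<infinity>" for n
  proof (induction n)
    case 0
    then show ?case using assms by (simp add: X_def)
  next
    case (Suc n)
    then show ?case using JZ[OF Suc] unfolding X_Suc by auto
  qed
  define a where "a n = real_of_ereal (l (X n))" for n
  have a: "l (X n) = ereal (a n)" for n
    using fin[of n] l_nonpos[of "X n"] unfolding a_def by (cases "l (X n)") auto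
  have step: "\<phi> (J (X n)) (X (Suc n)) = X n" for n using JZ[OF fin] X_Suc by metis
  have a_step: "a (Suc n) + q (J (X n), X (Suc n)) = a n" for n using JZ[OF fin[of n]] a X_Suc by (metis ereal.inject plus_ereal.simps(1))
  have "incseq a" using a_step q_nonpos by (intro incseq_SucI) (metis add_le_same_cancel1 add.commute)
  moreover have "a n \<le> 0" for n using l_nonpos[of "X n"] a by simp
  ultimately obtain L where L: "a \<longlonglongrightarrow> L" "\<And>n. a n \<le> L" using incseq_convergent by blast
  define W where "W n m = map (\<lambda>k. J (X k)) [n..<m]" for n m
  have W: "foldr \<phi> (W n m) (X m) = X n \<and> mane_sum \<phi> q (W n m) (X m) = a n - a m" if "n \<le> m" for n m
    using that
  proof (induction n rule: inc_induct)
    case base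
    then show ?case by (simp add: W_def mane_sum_Nil)
  next
    case (step n)
    have "W n m = J (X n) # W (Suc n) m" using step(2) by (simp add: W_def upt_conv_Cons)
    then show ?case using step(3) \<open>\<phi> (J (X n)) (X (Suc n)) = X n\<close> a_step[of n]
      by (simp add: mane_sum_Cons max_holonomic_q)
  qed
  obtain z s where s: "strict_mono s" and z: "(X \<circ> s) \<longlonglongrightarrow> z"
    using compact_X unfolding compact_def by blast
  define K where "K = C / (1 - \<gamma>)"
  have "K \<ge> 0" using C_nonneg \<gamma>_less_1 by (simp add: K_def)
  have W_dist: "dist (X n) (foldr \<phi> (W n m) z) \<le> dist (X m) z" if "n \<le> m" for n m
  proof -
    have "dist (X n) (foldr \<phi> (W n m) z) \<le> \<gamma> ^ length (W n m) * dist (X m) z"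
      using W[OF that] dist_foldr_le[of "W n m" "X m" z] by simp
    also have "\<dots> \<le> 1 * dist (X m) z" using \<gamma>_pos \<gamma>_less_1 by (intro mult_right_mono power_le_one) auto
    finally show ?thesis by simp
  qed
  have W_sum: "a n - L - K * dist (X m) z \<le> mane_sum \<phi> q (W n m) z" if "n \<le> m" for n m
    using W[OF that] mane_sum_distortion[OF q_lipschitz C_nonneg, of "W n m" "X m" z] L(2)[of m]
    unfolding K_def by (simp add: abs_le_iff)
  have visit: "\<exists>m>N. dist (X m) z < d \<and> L - d < a m" if "d > 0" for N d
  proof -
    have "\<forall>\<^sub>F n in sequentially. dist (X (s n)) z < d" using z that unfolding tendsto_iff by simp
    moreover have "\<forall>\<^sub>F n in sequentially. L - d < a (s n)"
      using LIMSEQ_subseq_LIMSEQ[OF L(1) s] that by (intro order_tendstoD(1)) (auto simp: o_def)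
    moreover have "\<forall>\<^sub>F n in sequentially. N < s n"
      using eventually_gt_at_top[of N] by eventually_elim (metis s seq_suble less_le_trans)
    ultimately have "\<forall>\<^sub>F n in sequentially. N < s n \<and> dist (X (s n)) z < d \<and> L - d < a (s n)"
      by eventually_elim auto
    then show ?thesis by (auto dest: eventually_happens)
  qed
  have W_ne: "W n m \<noteq> []" if "n < m" for n m using that by (simp add: W_def)
  \<comment> \<open>At distances below \<open>e / (2 (K + 1))\<close>, both the distance and its distortion by \<open>K\<close> are at most \<open>e / 2\<close>.\<close>
  have K_small: "K * t \<le> e / 2" if "t < e / (2 * (K + 1))" "e > 0" for t e
  proof -
    have "K * t \<le> K * (e / (2 * (K + 1)))" using that \<open>K \<ge> 0\<close> by (intro mult_left_mono) auto
    also have "\<dots> \<le> (K + 1) * (e / (2 * (K + 1)))" using that \<open>K \<ge> 0\<close> by (intro mult_right_mono) auto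
    also have "\<dots> = e / 2" using \<open>K \<ge> 0\<close> by (simp add: divide_simps)
    finally show ?thesis .
  qed
  have K_small': "e / (2 * (K + 1)) \<le> e / 2" if "e > 0" for e
    using that \<open>K \<ge> 0\<close> by (intro divide_left_mono) auto
  have "ereal 0 \<le> mane_potential \<phi> q z z"
  proof (rule mane_potential_geI)
    fix e :: real assume "e > 0"
    define d where "d = e / (2 * (K + 1))"
    have "d > 0" using \<open>e > 0\<close> \<open>K \<ge> 0\<close> by (simp add: d_def)
    obtain n where n: "dist (X n) z < d" "L - d < a n" using visit[OF \<open>d > 0\<close>] by blast
    obtain m where m: "n < m" "dist (X m) z < d" using visit[OF \<open>d > 0\<close>] by blast
    have "dist z (foldr \<phi> (W n m) z) \<le> dist (X n) z + dist (X n) (foldr \<phi> (W n m) z)"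
      by (metis dist_commute dist_triangle)
    also have "\<dots> < e" using n m W_dist[of n m] K_small'[OF \<open>e > 0\<close>] unfolding d_def by linarith
    finally have "dist z (foldr \<phi> (W n m) z) < e" .
    moreover have "0 - e \<le> mane_sum \<phi> q (W n m) z"
      using W_sum[of n m] K_small[of "dist (X m) z" e] K_small'[of e] n m \<open>e > 0\<close> unfolding d_def by linarith
    ultimately show "\<exists>\<omega>. \<omega> \<noteq> [] \<and> dist z (foldr \<phi> \<omega> z) < e \<and> 0 - e \<le> mane_sum \<phi> q \<omega> z"
      using W_ne[OF m(1)] by blast
  qed
  then have "z \<in> aubry_set \<phi> q"
    using mane_potential_nonpos[of z z] unfolding aubry_set_def by (auto simp: zero_ereal_def)
  moreover have "ereal (a 0 - L) \<le> mane_potential \<phi> q x z"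
  proof (rule mane_potential_geI)
    fix e :: real assume "e > 0"
    define d where "d = e / (2 * (K + 1))"
    have "d > 0" using \<open>e > 0\<close> \<open>K \<ge> 0\<close> by (simp add: d_def)
    obtain m where m: "0 < m" "dist (X m) z < d" using visit[OF \<open>d > 0\<close>] by blast
    have "dist x (foldr \<phi> (W 0 m) z) < e"
      using W_dist[of 0 m, unfolded X_0] m K_small'[OF \<open>e > 0\<close>] \<open>e > 0\<close> unfolding d_def by linarith
    moreover have "a 0 - L - e \<le> mane_sum \<phi> q (W 0 m) z"
      using W_sum[of 0 m] K_small[of "dist (X m) z" e] m \<open>e > 0\<close> unfolding d_def by linarith
    ultimately show "\<exists>\<omega>. \<omega> \<noteq> [] \<and> dist x (foldr \<phi> \<omega> z) < e \<and> a 0 - L - e \<le> mane_sum \<phi> q \<omega> z"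
      using W_ne[OF m(1)] by blast
  qed
  then have "ereal (a 0 - L) + ereal L \<le> mane_potential \<phi> q x z + l z"
  proof (rule add_mono)
    show "ereal L \<le> l z"
    proof (rule upper_semicontinuous_sequentially[OF usc z])
      show "(a \<circ> s) \<longlonglongrightarrow> L" by (rule LIMSEQ_subseq_LIMSEQ[OF L(1) s])
    qed (simp add: a)
  qed
  then have "l x \<le> mane_potential \<phi> q x z + l z" using a[of 0] by (simp add: X_def)
  ultimately show ?thesis by blast
qed

theorem density_representation: "l x = (SUP z\<in>aubry_set \<phi> q. mane_potential \<phi> q x z + l z)"
proof (rule antisym)
  show "l x \<le> (SUP z\<in>aubry_set \<phi> q. mane_potential \<phi> q x z + l z)"
  proof (cases "l x = - \<infinity>")
    case False
    then show ?thesis using density_le_aubry by (meson SUP_upper2)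
  qed simp
  show "(SUP z\<in>aubry_set \<phi> q. mane_potential \<phi> q x z + l z) \<le> l x"
    by (intro SUP_least density_ge_mane_potential)
qed

end


section \<open>Calibrated functions\<close>

lemma cSUP_add_const:
  fixes f :: "'a \<Rightarrow> real"
  assumes "S \<noteq> {}" and "bdd_above (f ` S)"
  shows "(SUP j\<in>S. f j + a) = (SUP j\<in>S. f j) + a"
proof (rule antisym)
  obtain M where "\<And>j. j \<in> S \<Longrightarrow> f j \<le> M" using assms(2) unfolding bdd_above_def by auto
  then have bdd: "bdd_above ((\<lambda>j. f j + a) ` S)" by (intro bdd_aboveI2[of _ _ "M + a"]) auto
  show "(SUP j\<in>S. f j + a) \<le> (SUP j\<in>S. f j) + a"
    using assms by (intro cSUP_least) (auto intro: cSUP_upper)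
  have "(SUP j\<in>S. f j) \<le> (SUP j\<in>S. f j + a) - a"
    using assms(1) cSUP_upper[OF _ bdd] by (intro cSUP_least) (auto simp: le_diff_eq)
  then show "(SUP j\<in>S. f j) + a \<le> (SUP j\<in>S. f j + a)" by simp
qed

context contractive_ifs
begin

text \<open>
  The equation expresses \<open>V\<close> at \<open>x\<close> by its values at the points \<open>\<phi> j x\<close>, so it trades the oscillation
  of \<open>V\<close> at distance \<open>d\<close> for \<open>L d\<close> and its oscillation at distance \<open>\<gamma> d\<close>.  Iteration sums a geometric
  series, and the remaining oscillation tends to zero by uniform continuity.
\<close>

lemma calibrated_lipschitz:
  assumes A: "\<And>j x y. \<bar>A (j, x) - A (j, y)\<bar> \<le> L * dist x y" and "L \<ge> 0"
    and A_cont: "continuous_on UNIV A" and V: "continuous_on UNIV V"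
    and cal: "\<And>x. V x + c = (SUP j. A (j, x) + V (\<phi> j x))"
  shows "\<bar>V x - V y\<bar> \<le> L / (1 - \<gamma>) * dist x y"
proof -
  have bdd: "bdd_above (range (\<lambda>j. A (j, x) + V (\<phi> j x)))" for x
    using bdd_above_section[OF compact_J compact_X continuous_on_add[OF A_cont continuous_comp_phi[OF V]], of x]
    by simp
  have iterate: "\<bar>V x - V y\<bar> \<le> L * (\<Sum>k<n. \<gamma> ^ k) * dist x y + e"
    if "\<And>u v. dist u v \<le> \<gamma> ^ n * dist x y \<Longrightarrow> \<bar>V u - V v\<bar> \<le> e" for n x y e
    using that
  proof (induction n arbitrary: x y)
    case 0
    then show ?case by simp
  next
    case (Suc n)
    have phi: "dist (\<phi> j x) (\<phi> j y) \<le> \<gamma> * dist x y" for j using contraction[of j x j y] by simp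
    have "\<bar>V (\<phi> j x) - V (\<phi> j y)\<bar> \<le> L * (\<Sum>k<n. \<gamma> ^ k) * dist (\<phi> j x) (\<phi> j y) + e" for j
    proof (rule Suc.IH)
      fix u v :: 'x assume "dist u v \<le> \<gamma> ^ n * dist (\<phi> j x) (\<phi> j y)"
      also have "\<dots> \<le> \<gamma> ^ n * (\<gamma> * dist x y)" using \<gamma>_pos phi by (intro mult_left_mono) auto
      finally show "\<bar>V u - V v\<bar> \<le> e" by (intro Suc.prems) (simp add: mult_ac)
    qed
    moreover have "L * (\<Sum>k<n. \<gamma> ^ k) * dist (\<phi> j x) (\<phi> j y) \<le> L * (\<Sum>k<n. \<gamma> ^ k) * (\<gamma> * dist x y)" for j
      using \<gamma>_pos \<open>L \<ge> 0\<close> phi by (intro mult_left_mono mult_nonneg_nonneg sum_nonneg) auto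
    ultimately have osc: "\<bar>V (\<phi> j x) - V (\<phi> j y)\<bar> \<le> L * (\<Sum>k<n. \<gamma> ^ k) * (\<gamma> * dist x y) + e" for j
      by (meson add_right_mono order_trans)
    have "\<bar>(A (j, x) + V (\<phi> j x)) - (A (j, y) + V (\<phi> j y))\<bar>
        \<le> L * dist x y + (L * (\<Sum>k<n. \<gamma> ^ k) * (\<gamma> * dist x y) + e)" for j
      using osc[of j] A[of j x y] by linarith
    then have "\<bar>(V x + c) - (V y + c)\<bar> \<le> L * dist x y + (L * (\<Sum>k<n. \<gamma> ^ k) * (\<gamma> * dist x y) + e)"
      unfolding cal by (intro abs_SUP_diff_le bdd)
    moreover have "(\<Sum>k<Suc n. \<gamma> ^ k) = 1 + \<gamma> * (\<Sum>k<n. \<gamma> ^ k)"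
      by (simp add: sum.lessThan_Suc_shift sum_distrib_left del: sum.lessThan_Suc)
    ultimately show ?case by (simp add: algebra_simps del: sum.lessThan_Suc)
  qed
  have "\<bar>V x - V y\<bar> \<le> L / (1 - \<gamma>) * dist x y + e" if "e > 0" for e
  proof -
    have "uniformly_continuous_on UNIV V" using V compact_X by (rule compact_uniformly_continuous)
    then obtain d where d: "d > 0" "\<And>u v. dist v u < d \<Longrightarrow> dist (V v) (V u) < e"
      using \<open>e > 0\<close> unfolding uniformly_continuous_on_def by (metis UNIV_I)
    have "(\<lambda>n. \<gamma> ^ n * dist x y) \<longlonglongrightarrow> 0 * dist x y"
      using \<gamma>_pos \<gamma>_less_1 by (intro tendsto_intros LIMSEQ_realpow_zero) auto
    then have "\<forall>\<^sub>F n in sequentially. \<gamma> ^ n * dist x y < d" using d(1) by (intro order_tendstoD(2)) auto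
    then obtain n where n: "\<gamma> ^ n * dist x y < d" by (auto dest: eventually_happens)
    have "\<bar>V x - V y\<bar> \<le> L * (\<Sum>k<n. \<gamma> ^ k) * dist x y + e"
    proof (rule iterate)
      fix u v :: 'x assume "dist u v \<le> \<gamma> ^ n * dist x y"
      then show "\<bar>V u - V v\<bar> \<le> e" using d(2)[of u v] n by (simp add: dist_real_def)
    qed
    also have "\<dots> \<le> L * (1 / (1 - \<gamma>)) * dist x y + e"
      using \<open>L \<ge> 0\<close> sum_power_gamma_le by (intro add_right_mono mult_right_mono mult_left_mono) auto
    finally show ?thesis by simp
  qed
  then show ?thesis by (rule field_le_epsilon)
qed

lemma holonomic_integrable:
  fixes f :: "'j \<times> 'x \<Rightarrow> real"
  assumes "\<pi> \<in> holonomic \<phi>" and "continuous_on UNIV f"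
  shows "integrable \<pi> f"
  using assms borel_probability_integrable compact_UNIV_Pair[OF compact_J compact_X]
  unfolding holonomic_def by blast

lemma holonomic_integral_coboundary:
  fixes A :: "'j \<times> 'x \<Rightarrow> real" and V :: "'x \<Rightarrow> real"
  assumes \<pi>: "\<pi> \<in> holonomic \<phi>" and A: "continuous_on UNIV A" and V: "continuous_on UNIV V"
  shows "(\<integral>z. A z + V (\<phi> (fst z) (snd z)) - V (snd z) - c \<partial>\<pi>) = (\<integral>z. A z \<partial>\<pi>) - c"
proof -
  interpret prob_space \<pi> using \<pi> by (simp add: holonomic_def borel_probability_def)
  have V_snd: "continuous_on UNIV (\<lambda>z::'j \<times> 'x. V (snd z))"
    by (rule continuous_on_compose2[OF V continuous_on_snd[OF continuous_on_id]]) auto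
  note int = holonomic_integrable[OF \<pi>]
  have "(\<integral>z. V (snd z) \<partial>\<pi>) = (\<integral>z. V (\<phi> (fst z) (snd z)) \<partial>\<pi>)"
    using \<pi> V unfolding holonomic_def case_prod_beta' mem_Collect_eq by blast
  then show ?thesis
    using int[OF A] int[OF V_snd] int[OF continuous_comp_phi[OF V]] by (simp add: prob_space)
qed

end


section \<open>Zero-temperature limits of Gibbs probabilities\<close>

locale gibbs_family = contractive_ifs \<phi> \<gamma>
  for \<phi> :: "'j::metric_space \<Rightarrow> 'x::metric_space \<Rightarrow> 'x" and \<gamma> +
  fixes \<nu> :: "'j measure" and A :: "'j \<times> 'x \<Rightarrow> real" and L :: real
    and lam :: "real \<Rightarrow> real" and h :: "real \<Rightarrow> 'x \<Rightarrow> real" and \<rho> :: "real \<Rightarrow> 'x measure"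
    and V :: "'x \<Rightarrow> real"
  assumes \<nu>: "borel_probability \<nu>" and full_support: "measure_support \<nu> = UNIV"
    and A_lipschitz: "L-lipschitz_on UNIV A"
    and eigenpair: "\<beta> > 0 \<Longrightarrow> gibbs_eigenpair \<phi> \<nu> A \<beta> (lam \<beta>) (h \<beta>)"
    and gibbs: "\<beta> > 0 \<Longrightarrow> gibbs_probability \<phi> \<nu> A \<beta> (lam \<beta>) (h \<beta>) (\<rho> \<beta>)"
    and V_limit: "uniform_limit UNIV (\<lambda>\<beta> x. 1 / \<beta> * ln (h \<beta> x)) V at_top"
begin

lemma A_cont: "continuous_on UNIV A"
  using A_lipschitz by (rule lipschitz_on_continuous_on)

lemma lam_pos: "\<beta> > 0 \<Longrightarrow> lam \<beta> > 0"
  and h_pos: "\<beta> > 0 \<Longrightarrow> h \<beta> x > 0"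
  and h_cont: "\<beta> > 0 \<Longrightarrow> continuous_on UNIV (h \<beta>)"
  and eigen: "\<beta> > 0 \<Longrightarrow> (\<integral>j. exp (\<beta> * A (j, x)) * h \<beta> (\<phi> j x) \<partial>\<nu>) = lam \<beta> * h \<beta> x"
  using eigenpair[of \<beta>] unfolding gibbs_eigenpair_def transfer_operator_def by auto

lemma \<rho>_borel: "\<beta> > 0 \<Longrightarrow> borel_probability (\<rho> \<beta>)"
  and \<rho>_invariant: "\<beta> > 0 \<Longrightarrow> continuous_on UNIV f \<Longrightarrow>
    (\<integral>x. f x \<partial>\<rho> \<beta>) = (\<integral>x. (\<integral>j. gibbs_weight \<phi> A \<beta> (lam \<beta>) (h \<beta>) (j, x) * f (\<phi> j x) \<partial>\<nu>) \<partial>\<rho> \<beta>)"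
  using gibbs[of \<beta>] unfolding gibbs_probability_def by auto

definition log_h :: "real \<Rightarrow> 'x \<Rightarrow> real" where
  "log_h \<beta> x = 1 / \<beta> * ln (h \<beta> x)"

lemma h_eq: "\<beta> > 0 \<Longrightarrow> h \<beta> x = exp (\<beta> * log_h \<beta> x)"
  using h_pos[of \<beta> x] by (simp add: log_h_def)

lemma log_h_cont: "\<beta> > 0 \<Longrightarrow> continuous_on UNIV (log_h \<beta>)"
  unfolding log_h_def using h_cont h_pos by (intro continuous_intros) (auto simp: less_imp_neq[symmetric])

lemma log_h_limit: "uniform_limit UNIV log_h V at_top"
  using V_limit unfolding log_h_def .

lemma V_cont: "continuous_on UNIV V"
proof (rule uniform_limit_theorem[OF _ log_h_limit])
  show "\<forall>\<^sub>F \<beta> in at_top. continuous_on UNIV (log_h \<beta>)"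
    using eventually_gt_at_top[of 0] by eventually_elim (rule log_h_cont)
qed simp

definition coboundary_potential :: "('x \<Rightarrow> real) \<Rightarrow> 'j \<times> 'x \<Rightarrow> real" where
  "coboundary_potential U z = A z + U (\<phi> (fst z) (snd z)) - U (snd z)"

lemma coboundary_potential_cont:
  assumes "continuous_on UNIV U"
  shows "continuous_on UNIV (coboundary_potential U)"
proof -
  have "continuous_on UNIV (\<lambda>z::'j \<times> 'x. U (snd z))"
    by (rule continuous_on_compose2[OF assms continuous_on_snd[OF continuous_on_id]]) auto
  then show ?thesis
    unfolding coboundary_potential_def by (intro continuous_intros A_cont continuous_comp_phi assms)
qed

lemma coboundary_potential_limit:
  "uniform_limit UNIV (\<lambda>\<beta>. coboundary_potential (log_h \<beta>)) (coboundary_potential V) at_top"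
  unfolding coboundary_potential_def
proof (intro uniform_limit_intros)
  show "uniform_limit UNIV (\<lambda>\<beta> z::'j \<times> 'x. log_h \<beta> (\<phi> (fst z) (snd z))) (\<lambda>z. V (\<phi> (fst z) (snd z))) at_top"
    by (rule uniform_limit_compose'[OF log_h_limit]) auto
  show "uniform_limit UNIV (\<lambda>\<beta> z::'j \<times> 'x. log_h \<beta> (snd z)) (\<lambda>z. V (snd z)) at_top"
    by (rule uniform_limit_compose'[OF log_h_limit]) auto
qed

definition log_weight :: "real \<Rightarrow> 'j \<times> 'x \<Rightarrow> real" where
  "log_weight \<beta> z = coboundary_potential (log_h \<beta>) z - 1 / \<beta> * ln (lam \<beta>)"

lemma gibbs_weight_eq_exp:
  assumes "\<beta> > 0"
  shows "gibbs_weight \<phi> A \<beta> (lam \<beta>) (h \<beta>) z = exp (\<beta> * log_weight \<beta> z)"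
proof -
  have "exp (\<beta> * log_weight \<beta> z)
      = exp (\<beta> * A z + \<beta> * log_h \<beta> (\<phi> (fst z) (snd z)) - \<beta> * log_h \<beta> (snd z) - ln (lam \<beta>))"
    using assms unfolding log_weight_def coboundary_potential_def by (simp add: algebra_simps)
  also have "\<dots> = exp (\<beta> * A z) * h \<beta> (\<phi> (fst z) (snd z)) / (lam \<beta> * h \<beta> (snd z))"
    using lam_pos[OF assms] h_eq[OF assms] by (simp add: exp_diff exp_add)
  finally show ?thesis by (simp add: gibbs_weight_def case_prod_beta')
qed

lemma log_weight_cont: "\<beta> > 0 \<Longrightarrow> continuous_on UNIV (log_weight \<beta>)"
  unfolding log_weight_def by (intro continuous_intros coboundary_potential_cont log_h_cont)

lemma exp_log_weight_cont: "\<beta> > 0 \<Longrightarrow> continuous_on UNIV (\<lambda>z. exp (\<beta> * log_weight \<beta> z))"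
  by (intro continuous_intros log_weight_cont)

text \<open>This is the eigenvalue equation divided by \<open>h \<beta> x\<close>, which makes the right-hand side independent of \<open>x\<close>.\<close>

lemma integral_coboundary_potential:
  assumes "\<beta> > 0"
  shows "(\<integral>j. exp (\<beta> * coboundary_potential (log_h \<beta>) (j, x)) \<partial>\<nu>) = lam \<beta>"
proof -
  have "(\<integral>j. exp (\<beta> * coboundary_potential (log_h \<beta>) (j, x)) \<partial>\<nu>)
      = (\<integral>j. exp (\<beta> * A (j, x)) * h \<beta> (\<phi> j x) / h \<beta> x \<partial>\<nu>)"
    by (rule Bochner_Integration.integral_cong)
      (simp_all add: coboundary_potential_def h_eq[OF assms] algebra_simps exp_add exp_diff)
  also have "\<dots> = (\<integral>j. exp (\<beta> * A (j, x)) * h \<beta> (\<phi> j x) \<partial>\<nu>) / h \<beta> x" by simp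
  also have "\<dots> = lam \<beta>" using eigen[OF assms] h_pos[OF assms, of x] by simp
  finally show ?thesis .
qed

lemma integral_weight:
  assumes "\<beta> > 0"
  shows "(\<integral>j. exp (\<beta> * log_weight \<beta> (j, x)) \<partial>\<nu>) = 1"
proof -
  have "(\<integral>j. exp (\<beta> * log_weight \<beta> (j, x)) \<partial>\<nu>)
      = (\<integral>j. exp (\<beta> * coboundary_potential (log_h \<beta>) (j, x)) / lam \<beta> \<partial>\<nu>)"
    using assms lam_pos[OF assms]
    by (intro Bochner_Integration.integral_cong) (simp_all add: log_weight_def right_diff_distrib exp_diff)
  also have "\<dots> = 1" using integral_coboundary_potential[OF assms] lam_pos[OF assms] by simp
  finally show ?thesis .
qed

lemma log_lam_limit: "((\<lambda>\<beta>. 1 / \<beta> * ln (lam \<beta>)) \<longlongrightarrow> (SUP j. coboundary_potential V (j, x))) at_top"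
proof (rule Lim_transform_eventually)
  show "((\<lambda>\<beta>. 1 / \<beta> * ln (\<integral>j. exp (\<beta> * coboundary_potential (log_h \<beta>) (j, x)) \<partial>\<nu>))
      \<longlongrightarrow> (SUP j. coboundary_potential V (j, x))) at_top"
    using laplace_uniform_limit[OF compact_J compact_X \<nu> full_support coboundary_potential_cont[OF V_cont]
        coboundary_potential_cont[OF log_h_cont] coboundary_potential_limit]
    by (rule tendsto_uniform_limitI) auto
  show "\<forall>\<^sub>F \<beta> in at_top. 1 / \<beta> * ln (\<integral>j. exp (\<beta> * coboundary_potential (log_h \<beta>) (j, x)) \<partial>\<nu>) = 1 / \<beta> * ln (lam \<beta>)"
    using eventually_gt_at_top[of 0] by eventually_elim (simp add: integral_coboundary_potential)
qed

text \<open>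
  The law of a pair \<open>(j, x)\<close> with \<open>x\<close> distributed by \<open>\<rho> \<beta>\<close> and \<open>j\<close> chosen with density \<open>exp (\<beta> log_weight)\<close>.
  The invariance of \<open>\<rho> \<beta>\<close> says that \<open>\<phi> j x\<close> has the same law as \<open>x\<close>, so that the joint law is holonomic.
\<close>

definition joint_gibbs :: "real \<Rightarrow> ('j \<times> 'x) measure" where
  "joint_gibbs \<beta> = density (\<nu> \<Otimes>\<^sub>M \<rho> \<beta>) (\<lambda>z. ennreal (exp (\<beta> * log_weight \<beta> z)))"

lemma sets_pair: "\<beta> > 0 \<Longrightarrow> sets (\<nu> \<Otimes>\<^sub>M \<rho> \<beta>) = sets borel"
  using \<nu> \<rho>_borel[of \<beta>] sets_borel_pair_compact[OF compact_J compact_X] sets_pair_measure_cong[of \<nu> borel "\<rho> \<beta>" borel]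
  unfolding borel_probability_def by simp

lemma pair_borel_probability: "\<beta> > 0 \<Longrightarrow> borel_probability (\<nu> \<Otimes>\<^sub>M \<rho> \<beta>)"
  using \<nu> \<rho>_borel[of \<beta>] sets_pair[of \<beta>] prob_space_pair[of \<nu> "\<rho> \<beta>"] unfolding borel_probability_def by simp

lemma integral_pair:
  fixes f :: "'j \<times> 'x \<Rightarrow> real"
  assumes "\<beta> > 0" and "continuous_on UNIV f"
  shows "(\<integral>z. f z \<partial>(\<nu> \<Otimes>\<^sub>M \<rho> \<beta>)) = (\<integral>x. (\<integral>j. f (j, x) \<partial>\<nu>) \<partial>\<rho> \<beta>)"
proof -
  interpret N: prob_space \<nu> using \<nu> by (simp add: borel_probability_def)
  interpret R: prob_space "\<rho> \<beta>" using \<rho>_borel[OF assms(1)] by (simp add: borel_probability_def)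
  interpret pair_sigma_finite \<nu> "\<rho> \<beta>" ..
  have "integrable (\<nu> \<Otimes>\<^sub>M \<rho> \<beta>) f"
    by (rule borel_probability_integrable[OF pair_borel_probability[OF assms(1)]
          compact_UNIV_Pair[OF compact_J compact_X] assms(2)])
  then show ?thesis using integral_snd[of "\<lambda>j x. f (j, x)"] by simp
qed

lemma integral_joint_gibbs:
  assumes "\<beta> > 0" and "continuous_on UNIV f"
  shows "(\<integral>z. f z \<partial>joint_gibbs \<beta>) = (\<integral>x. (\<integral>j. exp (\<beta> * log_weight \<beta> (j, x)) * f (j, x) \<partial>\<nu>) \<partial>\<rho> \<beta>)"
proof -
  note meas = borel_probability_measurable[OF pair_borel_probability[OF assms(1)]]
  have "(\<integral>z. f z \<partial>joint_gibbs \<beta>) = (\<integral>z. exp (\<beta> * log_weight \<beta> z) * f z \<partial>(\<nu> \<Otimes>\<^sub>M \<rho> \<beta>))"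
    unfolding joint_gibbs_def
    by (subst integral_density) (use meas[OF assms(2)] meas[OF exp_log_weight_cont[OF assms(1)]] in auto)
  also have "\<dots> = (\<integral>x. (\<integral>j. exp (\<beta> * log_weight \<beta> (j, x)) * f (j, x) \<partial>\<nu>) \<partial>\<rho> \<beta>)"
    by (intro integral_pair assms continuous_intros exp_log_weight_cont)
  finally show ?thesis .
qed

lemma joint_gibbs_holonomic:
  assumes "\<beta> > 0"
  shows "joint_gibbs \<beta> \<in> holonomic \<phi>"
proof -
  interpret R: prob_space "\<rho> \<beta>" using \<rho>_borel[OF assms(1)] by (simp add: borel_probability_def)
  note meas = borel_probability_measurable[OF pair_borel_probability[OF assms(1)] exp_log_weight_cont[OF assms]]
  have int: "integrable (\<nu> \<Otimes>\<^sub>M \<rho> \<beta>) (\<lambda>z. exp (\<beta> * log_weight \<beta> z))"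
    by (rule borel_probability_integrable[OF pair_borel_probability[OF assms(1)]
          compact_UNIV_Pair[OF compact_J compact_X] exp_log_weight_cont[OF assms]])
  have "(\<integral>z. exp (\<beta> * log_weight \<beta> z) \<partial>(\<nu> \<Otimes>\<^sub>M \<rho> \<beta>)) = 1"
    unfolding integral_pair[OF assms exp_log_weight_cont[OF assms]] integral_weight[OF assms]
    by (simp add: R.prob_space)
  moreover have "emeasure (joint_gibbs \<beta>) (space (joint_gibbs \<beta>)) = (\<integral>\<^sup>+z. ennreal (exp (\<beta> * log_weight \<beta> z)) \<partial>(\<nu> \<Otimes>\<^sub>M \<rho> \<beta>))"
    unfolding joint_gibbs_def using meas by (simp add: emeasure_density cong: nn_integral_cong)
  ultimately have "emeasure (joint_gibbs \<beta>) (space (joint_gibbs \<beta>)) = 1"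
    using nn_integral_eq_integral[OF int] by simp
  then have "prob_space (joint_gibbs \<beta>)" by (rule prob_spaceI)
  moreover have "sets (joint_gibbs \<beta>) = sets borel" using sets_pair[OF assms] by (simp add: joint_gibbs_def)
  ultimately have "borel_probability (joint_gibbs \<beta>)" by (simp add: borel_probability_def)
  moreover have "(\<integral>(j, x). g x \<partial>joint_gibbs \<beta>) = (\<integral>(j, x). g (\<phi> j x) \<partial>joint_gibbs \<beta>)"
    if g: "continuous_on UNIV g" for g :: "'x \<Rightarrow> real"
  proof -
    have g_snd: "continuous_on UNIV (\<lambda>z::'j \<times> 'x. g (snd z))"
      by (rule continuous_on_compose2[OF g continuous_on_snd[OF continuous_on_id]]) auto
    have "(\<integral>z. g (snd z) \<partial>joint_gibbs \<beta>) = (\<integral>x. g x \<partial>\<rho> \<beta>)"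
      unfolding integral_joint_gibbs[OF assms g_snd] by (simp add: integral_weight[OF assms])
    also have "\<dots> = (\<integral>z. g (\<phi> (fst z) (snd z)) \<partial>joint_gibbs \<beta>)"
      unfolding \<rho>_invariant[OF assms g] integral_joint_gibbs[OF assms continuous_comp_phi[OF g]]
        gibbs_weight_eq_exp[OF assms] by simp
    finally show ?thesis by (simp add: case_prod_beta')
  qed
  ultimately show ?thesis by (simp add: holonomic_def)
qed

text \<open>
  The relative entropy of \<open>joint_gibbs \<beta>\<close> with respect to the product measure is nonnegative, by
  \<open>t ln t \<ge> t - 1\<close> for the weights \<open>t\<close>, whose integral over \<open>j\<close> is one.
\<close>

lemma log_lam_le:
  assumes "\<beta> > 0"
  shows "1 / \<beta> * ln (lam \<beta>) \<le> (\<integral>z. A z \<partial>joint_gibbs \<beta>)"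
proof -
  have cont: "continuous_on UNIV (\<lambda>z. exp (\<beta> * log_weight \<beta> z) * log_weight \<beta> z)"
    by (intro continuous_intros exp_log_weight_cont log_weight_cont assms)
  have inner: "(\<integral>j. exp (\<beta> * log_weight \<beta> (j, x)) * log_weight \<beta> (j, x) \<partial>\<nu>) \<ge> 0" for x
  proof -
    interpret N: prob_space \<nu> using \<nu> by (simp add: borel_probability_def)
    note int = borel_probability_integrable[OF \<nu> compact_J continuous_on_section]
    have "0 = (\<integral>j. (exp (\<beta> * log_weight \<beta> (j, x)) - 1) / \<beta> \<partial>\<nu>)"
      using int[OF exp_log_weight_cont[OF assms], of x] by (simp add: integral_weight[OF assms] N.prob_space)
    also have "\<dots> \<le> (\<integral>j. exp (\<beta> * log_weight \<beta> (j, x)) * log_weight \<beta> (j, x) \<partial>\<nu>)"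
    proof (rule integral_mono)
      show "integrable \<nu> (\<lambda>j. (exp (\<beta> * log_weight \<beta> (j, x)) - 1) / \<beta>)"
        using int[OF exp_log_weight_cont[OF assms], of x] by simp
      show "integrable \<nu> (\<lambda>j. exp (\<beta> * log_weight \<beta> (j, x)) * log_weight \<beta> (j, x))"
        by (rule int[OF cont])
      fix j
      define t where "t = \<beta> * log_weight \<beta> (j, x)"
      have "exp t * (1 - t) \<le> exp t * exp (- t)" using exp_ge_add_one_self[of "- t"] by (intro mult_left_mono) auto
      then have "exp t - 1 \<le> exp t * t" by (simp add: exp_minus algebra_simps)
      then have "(exp t - 1) / \<beta> \<le> exp t * t / \<beta>" using assms by (intro divide_right_mono) auto
      then show "(exp (\<beta> * log_weight \<beta> (j, x)) - 1) / \<beta> \<le> exp (\<beta> * log_weight \<beta> (j, x)) * log_weight \<beta> (j, x)"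
        using assms by (simp add: t_def)
    qed
    finally show ?thesis .
  qed
  have "0 \<le> (\<integral>z. log_weight \<beta> z \<partial>joint_gibbs \<beta>)"
    unfolding integral_joint_gibbs[OF assms log_weight_cont[OF assms]]
    using inner by (rule Bochner_Integration.integral_nonneg)
  also have "\<dots> = (\<integral>z. A z \<partial>joint_gibbs \<beta>) - 1 / \<beta> * ln (lam \<beta>)"
    unfolding log_weight_def coboundary_potential_def
    by (rule holonomic_integral_coboundary[OF joint_gibbs_holonomic[OF assms] A_cont log_h_cont[OF assms]])
  finally show ?thesis by simp
qed

text \<open>
  The supremum of the coboundary potential bounds every holonomic integral of \<open>A\<close>, because the coboundary
  integrates to zero.  The entropy inequality shows that the joint Gibbs probabilities reach it in the
  limit.
\<close>

lemma SUP_coboundary_potential: "(SUP j. coboundary_potential V (j, x)) = max_holonomic \<phi> A"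
  and bdd_above_holonomic: "bdd_above ((\<lambda>\<pi>. \<integral>z. A z \<partial>\<pi>) ` holonomic \<phi>)"
proof -
  define c where "c = (SUP j. coboundary_potential V (j, x))"
  have c: "(SUP j. coboundary_potential V (j, y)) = c" for y
    using tendsto_unique[OF _ log_lam_limit log_lam_limit] unfolding c_def by auto
  have "coboundary_potential V (j, y) \<le> c" for j y
    using cSUP_upper[OF UNIV_I bdd_above_section[OF compact_J compact_X coboundary_potential_cont[OF V_cont]], of j y]
    unfolding c .
  then have le: "coboundary_potential V z - 0 \<le> c" for z by (cases z) auto
  have upper: "(\<integral>z. A z \<partial>\<pi>) \<le> c" if "\<pi> \<in> holonomic \<phi>" for \<pi>
  proof -
    interpret prob_space \<pi> using that by (simp add: holonomic_def borel_probability_def)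
    have "(\<integral>z. A z \<partial>\<pi>) = (\<integral>z. coboundary_potential V z - 0 \<partial>\<pi>)"
      unfolding coboundary_potential_def holonomic_integral_coboundary[OF that A_cont V_cont] by simp
    also have "\<dots> \<le> (\<integral>z. c \<partial>\<pi>)"
      using holonomic_integrable[OF that coboundary_potential_cont[OF V_cont]] le by (intro integral_mono) auto
    finally show ?thesis by (simp add: prob_space)
  qed
  then show bdd: "bdd_above ((\<lambda>\<pi>. \<integral>z. A z \<partial>\<pi>) ` holonomic \<phi>)" by (auto intro!: bdd_aboveI)
  have "holonomic \<phi> \<noteq> {}" using joint_gibbs_holonomic[of 1] by auto
  then have "max_holonomic \<phi> A \<le> c" unfolding max_holonomic_def using upper by (rule cSUP_least)
  moreover have "c \<le> max_holonomic \<phi> A"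
  proof (rule tendsto_upperbound[OF log_lam_limit[of x, folded c_def]])
    show "\<forall>\<^sub>F \<beta> in at_top. 1 / \<beta> * ln (lam \<beta>) \<le> max_holonomic \<phi> A"
      using eventually_gt_at_top[of 0]
    proof eventually_elim
      case (elim \<beta>)
      show ?case unfolding max_holonomic_def
        by (rule order_trans[OF log_lam_le[OF elim] cSUP_upper[OF joint_gibbs_holonomic[OF elim] bdd]])
    qed
  qed simp
  ultimately show "(SUP j. coboundary_potential V (j, x)) = max_holonomic \<phi> A" unfolding c_def by simp
qed

definition q :: "'j \<times> 'x \<Rightarrow> real" where
  "q z = coboundary_potential V z - max_holonomic \<phi> A"

lemma q_cont: "continuous_on UNIV q"
  unfolding q_def by (intro continuous_intros coboundary_potential_cont V_cont)

lemma log_weight_limit: "uniform_limit UNIV log_weight q at_top"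
proof -
  have "((\<lambda>\<beta>. 1 / \<beta> * ln (lam \<beta>)) \<longlongrightarrow> max_holonomic \<phi> A) at_top"
    using log_lam_limit unfolding SUP_coboundary_potential .
  then have "uniform_limit UNIV (\<lambda>\<beta> z::'j \<times> 'x. 1 / \<beta> * ln (lam \<beta>)) (\<lambda>z. max_holonomic \<phi> A) at_top"
    unfolding uniform_limit_iff tendsto_iff by simp
  then show ?thesis
    unfolding log_weight_def q_def by (rule uniform_limit_minus[OF coboundary_potential_limit])
qed

lemma SUP_q: "(SUP j. q (j, x)) = 0"
  using cSUP_add_const[OF _ bdd_above_section[OF compact_J compact_X coboundary_potential_cont[OF V_cont]],
      of x "- max_holonomic \<phi> A"] SUP_coboundary_potential[of x]
  unfolding q_def by simp

lemma q_nonpos: "q z \<le> 0"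
  using cSUP_upper[OF UNIV_I bdd_above_section[OF compact_J compact_X q_cont], of "fst z" "snd z"] SUP_q[of "snd z"]
  by simp

lemma max_holonomic_q: "max_holonomic \<phi> q = 0"
proof -
  have "max_holonomic \<phi> q = (SUP \<pi>\<in>holonomic \<phi>. (\<integral>z. A z \<partial>\<pi>) + (- max_holonomic \<phi> A))"
    unfolding max_holonomic_def[of \<phi> q] q_def coboundary_potential_def
    by (intro SUP_cong refl) (simp add: holonomic_integral_coboundary[OF _ A_cont V_cont])
  also have "\<dots> = (SUP \<pi>\<in>holonomic \<phi>. \<integral>z. A z \<partial>\<pi>) + (- max_holonomic \<phi> A)"
    using joint_gibbs_holonomic[of 1] by (intro cSUP_add_const bdd_above_holonomic) auto
  finally show ?thesis by (simp add: max_holonomic_def)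
qed

lemma q_lipschitz: "\<exists>C>0. \<forall>j x y. \<bar>q (j, x) - q (j, y)\<bar> \<le> C * dist x y"
proof -
  have "L \<ge> 0" using A_lipschitz by (rule lipschitz_on_nonneg)
  have A: "\<bar>A (j, x) - A (j, y)\<bar> \<le> L * dist x y" for j x y
    using lipschitz_onD[OF A_lipschitz, of "(j, x)" "(j, y)"] by (simp add: dist_Pair_Pair dist_real_def)
  define K where "K = L / (1 - \<gamma>)"
  have "K \<ge> 0" using \<open>L \<ge> 0\<close> \<gamma>_less_1 by (simp add: K_def)
  have V: "\<bar>V x - V y\<bar> \<le> K * dist x y" for x y
    unfolding K_def
  proof (rule calibrated_lipschitz[OF A \<open>L \<ge> 0\<close> A_cont V_cont])
    fix x
    show "V x + max_holonomic \<phi> A = (SUP j. A (j, x) + V (\<phi> j x))"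
      using cSUP_add_const[OF _ bdd_above_section[OF compact_J compact_X coboundary_potential_cont[OF V_cont]], of x "V x"]
        SUP_coboundary_potential[of x] by (simp add: coboundary_potential_def)
  qed
  have "\<bar>q (j, x) - q (j, y)\<bar> \<le> (L + 2 * K + 1) * dist x y" for j x y
  proof -
    have "dist (\<phi> j x) (\<phi> j y) \<le> \<gamma> * dist x y" using contraction[of j x j y] by simp
    also have "\<dots> \<le> 1 * dist x y" using \<gamma>_less_1 by (intro mult_right_mono) auto
    finally have "K * dist (\<phi> j x) (\<phi> j y) \<le> K * dist x y" using \<open>K \<ge> 0\<close> by (intro mult_left_mono) auto
    then have "\<bar>V (\<phi> j x) - V (\<phi> j y)\<bar> \<le> K * dist x y" using V[of "\<phi> j x" "\<phi> j y"] by linarith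
    then have "\<bar>q (j, x) - q (j, y)\<bar> \<le> L * dist x y + K * dist x y + K * dist x y"
      using A[of j x y] V[of x y] unfolding q_def coboundary_potential_def by (simp add: abs_le_iff)
    also have "\<dots> \<le> (L + 2 * K + 1) * dist x y" by (simp add: algebra_simps)
    finally show ?thesis .
  qed
  then show ?thesis using \<open>L \<ge> 0\<close> \<open>K \<ge> 0\<close> by (intro exI[of _ "L + 2 * K + 1"]) auto
qed

text \<open>
  The invariance of the Gibbs probabilities turns into max-plus invariance under \<open>1/\<beta> ln\<close>: Varadhan's
  lemma evaluates the integral over \<open>x\<close> on both sides, and the Laplace principle the integral over \<open>j\<close>.
\<close>

lemma maxplus_integral_invariant:
  assumes ldp: "large_deviation_principle \<rho> I" and f: "continuous_on UNIV f"
  shows "maxplus_integral (\<lambda>x. - I x) f = maxplus_integral (\<lambda>x. - I x) (\<lambda>x. SUP j. q (j, x) + f (\<phi> j x))"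
proof -
  define G where "G z = q z + f (\<phi> (fst z) (snd z))" for z
  define H where "H \<beta> z = log_weight \<beta> z + f (\<phi> (fst z) (snd z))" for \<beta> z
  define F where "F \<beta> x = 1 / \<beta> * ln (\<integral>j. exp (\<beta> * H \<beta> (j, x)) \<partial>\<nu>)" for \<beta> x
  have G: "continuous_on UNIV G" unfolding G_def by (intro continuous_intros q_cont continuous_comp_phi f)
  have H: "continuous_on UNIV (H \<beta>)" if "\<beta> > 0" for \<beta>
    unfolding H_def by (intro continuous_intros log_weight_cont continuous_comp_phi f that)
  have "uniform_limit UNIV H G at_top"
    unfolding H_def G_def by (intro uniform_limit_intros log_weight_limit)
  then have F_lim: "uniform_limit UNIV F (\<lambda>x. SUP j. G (j, x)) at_top"
    unfolding F_def by (intro laplace_uniform_limit compact_J compact_X \<nu> full_support G H)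
  have pos: "(\<integral>j. exp (\<beta> * H \<beta> (j, x)) \<partial>\<nu>) > 0" if "\<beta> > 0" for \<beta> x
    using continuous_on_section[OF H[OF that]]
    by (intro exp_integral_positive[OF compact_J \<nu>] continuous_intros)
  have F_cont: "continuous_on UNIV (F \<beta>)" if "\<beta> > 0" for \<beta>
  proof -
    have "continuous_on UNIV (\<lambda>x. \<integral>j. exp (\<beta> * H \<beta> (j, x)) \<partial>\<nu>)"
      by (rule continuous_on_integral_section[OF compact_J compact_X _ \<nu>]) (intro continuous_intros H that)
    then show ?thesis unfolding F_def using pos[OF that]
      by (intro continuous_intros) (auto simp: less_imp_neq[symmetric])
  qed
  have "((\<lambda>\<beta>. 1 / \<beta> * ln (\<integral>x. exp (\<beta> * F \<beta> x) \<partial>\<rho> \<beta>))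
      \<longlongrightarrow> maxplus_integral (\<lambda>x. - I x) (\<lambda>x. SUP j. G (j, x))) at_top"
    by (intro varadhan compact_X ldp \<rho>_borel continuous_on_SUP_section[OF compact_J compact_X G] F_cont F_lim)
  moreover have "((\<lambda>\<beta>. 1 / \<beta> * ln (\<integral>x. exp (\<beta> * f x) \<partial>\<rho> \<beta>)) \<longlongrightarrow> maxplus_integral (\<lambda>x. - I x) f) at_top"
    by (intro varadhan compact_X ldp \<rho>_borel f uniform_limit_const)
  then have "((\<lambda>\<beta>. 1 / \<beta> * ln (\<integral>x. exp (\<beta> * F \<beta> x) \<partial>\<rho> \<beta>)) \<longlongrightarrow> maxplus_integral (\<lambda>x. - I x) f) at_top"
  proof (rule Lim_transform_eventually)
    show "\<forall>\<^sub>F \<beta> in at_top. 1 / \<beta> * ln (\<integral>x. exp (\<beta> * f x) \<partial>\<rho> \<beta>) = 1 / \<beta> * ln (\<integral>x. exp (\<beta> * F \<beta> x) \<partial>\<rho> \<beta>)"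
      using eventually_gt_at_top[of 0]
    proof eventually_elim
      case (elim \<beta>)
      have "(\<integral>x. exp (\<beta> * f x) \<partial>\<rho> \<beta>)
          = (\<integral>x. (\<integral>j. exp (\<beta> * log_weight \<beta> (j, x)) * exp (\<beta> * f (\<phi> j x)) \<partial>\<nu>) \<partial>\<rho> \<beta>)"
        unfolding gibbs_weight_eq_exp[OF elim, symmetric] by (intro \<rho>_invariant[OF elim] continuous_intros f)
      also have "\<dots> = (\<integral>x. exp (\<beta> * F \<beta> x) \<partial>\<rho> \<beta>)"
        using elim pos[OF elim] by (simp add: F_def) (simp add: H_def distrib_left exp_add)
      finally show ?case by simp
    qed
  qed
  ultimately show ?thesis using tendsto_unique[OF trivial_limit_at_top_linorder] unfolding G_def by fastforce
qed

text \<open>It remains to pull the supremum over \<open>j\<close> out of the max-plus integral: suprema over \<open>j\<close> and \<open>x\<close> commute.\<close>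

lemma maxplus_invariant_rate:
  assumes ldp: "large_deviation_principle \<rho> I"
  shows "maxplus_invariant \<phi> q (maxplus_integral (\<lambda>x. - I x))"
  unfolding maxplus_invariant_def
proof (intro allI impI)
  fix f :: "'x \<Rightarrow> real" assume f: "continuous_on UNIV f"
  define l where "l x = - I x" for x
  define G where "G z = q z + f (\<phi> (fst z) (snd z))" for z
  define F where "F x = (SUP j. G (j, x))" for x
  have SUP_l: "(SUP x. l x) = 0" unfolding l_def by (rule large_deviation_rate_INF[OF ldp \<rho>_borel])
  have G: "continuous_on UNIV G" unfolding G_def by (intro continuous_intros q_cont continuous_comp_phi f)
  obtain M where M: "\<And>z. \<bar>G z\<bar> \<le> M"
    using compact_continuous_bounded[OF compact_UNIV_Pair[OF compact_J compact_X] G] by metis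
  note bdd = bdd_above_section[OF compact_J compact_X G]
  obtain M' where M': "\<And>x. \<bar>F x\<bar> \<le> M'"
    using compact_continuous_bounded[OF compact_X] continuous_on_SUP_section[OF compact_J compact_X G]
    unfolding F_def by metis
  define t where "t j = maxplus_integral l (\<lambda>x. G (j, x))" for j
  have t: "ereal (t j) = (SUP x. l x + ereal (G (j, x)))" for j
    unfolding t_def by (rule ereal_maxplus_integral[OF SUP_l M])
  have \<mu>F: "ereal (maxplus_integral l F) = (SUP x. l x + ereal (F x))" by (rule ereal_maxplus_integral[OF SUP_l M'])
  have t_le: "t j \<le> maxplus_integral l F" for j
  proof -
    have "ereal (t j) \<le> ereal (maxplus_integral l F)"
      unfolding t \<mu>F F_def by (intro SUP_mono' add_left_mono) (auto intro: cSUP_upper[OF _ bdd])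
    then show ?thesis by simp
  qed
  then have bdd_t: "bdd_above (range t)" by (auto intro!: bdd_aboveI)
  have "ereal (maxplus_integral l F) \<le> ereal (SUP j. t j)"
    unfolding \<mu>F
  proof (rule SUP_least)
    fix x
    have "G (j, x) \<le> (SUP j. t j) - b" if b: "l x = ereal b" for j b
    proof -
      have "l x + ereal (G (j, x)) \<le> ereal (t j)" unfolding t by (rule SUP_upper) simp
      also have "\<dots> \<le> ereal (SUP j. t j)" using cSUP_upper[OF UNIV_I bdd_t] by simp
      finally show ?thesis unfolding b by simp
    qed
    then have "F x \<le> (SUP j. t j) - b" if "l x = ereal b" for b
      unfolding F_def using that by (intro cSUP_least) auto
    moreover have "l x \<le> 0" using SUP_l by (metis SUP_upper UNIV_I)
    ultimately show "l x + ereal (F x) \<le> ereal (SUP j. t j)" by (cases "l x") fastforce+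
  qed
  moreover have "(SUP j. t j) \<le> maxplus_integral l F" using t_le by (intro cSUP_least) auto
  ultimately have "maxplus_integral l F = (SUP j. t j)" by simp
  then show "maxplus_integral (\<lambda>x. - I x) f
      = (SUP j. maxplus_integral (\<lambda>x. - I x) (\<lambda>x. q (j, x) + f (\<phi> j x)))"
    using maxplus_integral_invariant[OF ldp f] unfolding F_def t_def l_def G_def by simp
qed

end


section \<open>The deviation function and the Aubry set\<close>

theorem theorem4p12:
  fixes \<phi> :: "'j::metric_space \<Rightarrow> 'x::metric_space \<Rightarrow> 'x"
    and \<nu> :: "'j measure"
    and A :: "'j \<times> 'x \<Rightarrow> real"
    and lam :: "real \<Rightarrow> real"
    and h :: "real \<Rightarrow> 'x \<Rightarrow> real"
    and \<rho> :: "real \<Rightarrow> 'x measure"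
    and I :: "'x \<Rightarrow> ereal"
    and V :: "'x \<Rightarrow> real"
  assumes "compact (UNIV :: 'x set)" and "compact (UNIV :: 'j set)"
    and "uniformly_contractible \<phi>"
    and "borel_probability \<nu>" and "measure_support \<nu> = UNIV"
    and "\<exists>L. L-lipschitz_on UNIV A"
    and "\<And>\<beta>. \<beta> > 0 \<Longrightarrow> gibbs_eigenpair \<phi> \<nu> A \<beta> (lam \<beta>) (h \<beta>)"
    and "\<And>\<beta>. \<beta> > 0 \<Longrightarrow> gibbs_probability \<phi> \<nu> A \<beta> (lam \<beta>) (h \<beta>) (\<rho> \<beta>)"
    and "large_deviation_principle \<rho> I"
    and "uniform_limit UNIV (\<lambda>\<beta> x. 1 / \<beta> * ln (h \<beta> x)) V at_top"
  shows "\<exists>q. uniform_limit UNIV (\<lambda>\<beta> z. 1 / \<beta> * ln (gibbs_weight \<phi> A \<beta> (lam \<beta>) (h \<beta>) z)) q at_top \<and>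
           (\<forall>j x. q (j, x) = A (j, x) + V (\<phi> j x) - V x - max_holonomic \<phi> A) \<and>
           normalized_weights q \<and>
           (\<exists>\<mu>. idempotent_probability \<mu> \<and> idempotent_density \<mu> (\<lambda>x. - I x) \<and>
                maxplus_invariant \<phi> q \<mu>) \<and>
           (\<forall>x. - I x = (SUP z\<in>aubry_set \<phi> q. mane_potential \<phi> q x z - I z))"
proof -
  obtain \<gamma> where \<gamma>: "0 < \<gamma>" "\<gamma> < 1"
    "\<And>i j x y. dist (\<phi> i x) (\<phi> j y) \<le> \<gamma> * (dist i j + dist x y)"
    using assms(3) unfolding uniformly_contractible_def by blast
  obtain L where L: "L-lipschitz_on UNIV A" using assms(6) by blast
  interpret gibbs_family \<phi> \<gamma> \<nu> A L lam h \<rho> V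
    by unfold_locales (use assms \<gamma> L in auto)
  note ldp = assms(9)
  note SUP_I = large_deviation_rate_INF[OF ldp \<rho>_borel]
  define \<mu> where "\<mu> = maxplus_integral (\<lambda>x. - I x)"
  have \<mu>_eq: "ereal (\<mu> f) = (SUP x. - I x + ereal (f x))" if f: "continuous_on UNIV f" for f
  proof -
    obtain M where M: "\<And>x. \<bar>f x\<bar> \<le> M" using compact_continuous_bounded[OF compact_X f] by metis
    show ?thesis unfolding \<mu>_def by (rule ereal_maxplus_integral[OF SUP_I M])
  qed
  obtain C where C: "C > 0" "\<And>j x y. \<bar>q (j, x) - q (j, y)\<bar> \<le> C * dist x y" using q_lipschitz by blast
  interpret density: invariant_density \<phi> \<gamma> q C "\<lambda>x. - I x"
  proof
    show "- I x \<le> 0" for x using SUP_I by (metis SUP_upper UNIV_I)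
    fix f :: "'x \<Rightarrow> real" assume f: "continuous_on UNIV f"
    have "continuous_on UNIV (\<lambda>x. SUP j. q (j, x) + f (\<phi> j x))"
      using continuous_on_SUP_section[OF compact_J compact_X
          continuous_on_add[OF q_cont continuous_comp_phi[OF f]]] by simp
    from \<mu>_eq[OF this] show "(SUP x. - I x + ereal (f x)) = (SUP x. - I x + ereal (SUP j. q (j, x) + f (\<phi> j x)))"
      using \<mu>_eq[OF f] maxplus_integral_invariant[OF ldp f] unfolding \<mu>_def by simp
  qed (use q_cont C q_nonpos max_holonomic_q large_deviation_rate_usc[OF ldp] in auto)
  have "uniform_limit UNIV (\<lambda>\<beta> z. 1 / \<beta> * ln (gibbs_weight \<phi> A \<beta> (lam \<beta>) (h \<beta>) z)) q at_top"
  proof (rule uniform_limit_cong[THEN iffD2, OF _ _ log_weight_limit])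
    show "\<forall>\<^sub>F \<beta> in at_top. \<forall>z\<in>UNIV.
        1 / \<beta> * ln (gibbs_weight \<phi> A \<beta> (lam \<beta>) (h \<beta>) z) = log_weight \<beta> z"
      using eventually_gt_at_top[of 0] by eventually_elim (simp add: gibbs_weight_eq_exp)
  qed simp
  moreover have "\<forall>j x. q (j, x) = A (j, x) + V (\<phi> j x) - V x - max_holonomic \<phi> A"
    by (simp add: q_def coboundary_potential_def)
  moreover have "normalized_weights q"
    unfolding normalized_weights_def using q_cont q_lipschitz SUP_q by blast
  moreover have "idempotent_probability \<mu>"
    unfolding \<mu>_def by (rule idempotent_probability_maxplus_integral[OF compact_X SUP_I])
  moreover have "idempotent_density \<mu> (\<lambda>x. - I x)"
    unfolding idempotent_density_def using large_deviation_rate_usc[OF ldp] SUP_I \<mu>_eq by blast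
  moreover have "maxplus_invariant \<phi> q \<mu>" unfolding \<mu>_def by (rule maxplus_invariant_rate[OF ldp])
  moreover have "\<forall>x. - I x = (SUP z\<in>aubry_set \<phi> q. mane_potential \<phi> q x z - I z)"
    using density.density_representation unfolding minus_ereal_def by blast
  ultimately show ?thesis by blast
qed

end
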